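(* Let $v\in\langle\cdot\rangle^{-1}L^2(\mathbb{C})$ and let $u$ be the unique solution in $\langle\cdot\rangle L^2(\mathbb{C})$ of $\overline{\partial}u=v$. Then $$u(z)=\frac1\pi\int_{\mathbb{C}}\frac{1}{z-w}\,v(w)\,L(dw)$$ for almost every $z\in\mathbb{C}$, where the integral is well defined for almost every $z$.
   Context: For $z=x+iy\in\mathbb{C}$ put $\langle z\rangle=(1+|z|^2)^{1/2}$. For $\theta\in\mathbb{R}$, $\langle\cdot\rangle^{\theta}L^2(\mathbb{C})=\{\langle z\rangle^{\theta}u(z):\ u\in L^2(\mathbb{C})\}$, where $L^2(\mathbb{C})$ is taken with respect to Lebesgue measure $L(dw)$ on $\mathbb{C}\simeq\mathbb{R}^2$. The operator is $\overline{\partial}=\frac12(\partial_x+i\partial_y)$, and the equation $\overline\partial u=v$ is understood in the sense of distributions. It is known that for every $v\in\langle\cdot\rangle^{-1}L^2$ this equation has exactly one solution $u\in\langle\cdot\rangle L^2$. *)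

theory Defs
  imports "HOL-Analysis.Analysis"
begin

definition japanese_bracket :: "complex \<Rightarrow> real" where
  "japanese_bracket z = sqrt (1 + (cmod z)\<^sup>2)"

text \<open>Elements of the function spaces are representatives, not classes modulo null sets.\<close>

definition L2_complex :: "(complex \<Rightarrow> complex) set" where
  "L2_complex = {u. u \<in> borel_measurable lebesgue \<and> integrable lebesgue (\<lambda>z. (cmod (u z))\<^sup>2)}"

definition weighted_L2 :: "real \<Rightarrow> (complex \<Rightarrow> complex) set" where
  "weighted_L2 \<theta> = {(\<lambda>z. complex_of_real (japanese_bracket z powr \<theta>) * u z) | u. u \<in> L2_complex}"

definition partial_x :: "(complex \<Rightarrow> complex) \<Rightarrow> complex \<Rightarrow> complex" where
  "partial_x f z = vector_derivative (\<lambda>t. f (z + complex_of_real t)) (at 0)"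

definition partial_y :: "(complex \<Rightarrow> complex) \<Rightarrow> complex \<Rightarrow> complex" where
  "partial_y f z = vector_derivative (\<lambda>t. f (z + \<i> * complex_of_real t)) (at 0)"

definition dbar :: "(complex \<Rightarrow> complex) \<Rightarrow> complex \<Rightarrow> complex" where
  "dbar f z = (partial_x f z + \<i> * partial_y f z) / 2"

text \<open>Real differentiability in the sense of \<open>C\<^sup>k\<close> on the plane, not complex differentiability:
  \<open>differentiable\<close> refers to real-linear Frechet derivatives.\<close>

primrec Ck_plane :: "nat \<Rightarrow> (complex \<Rightarrow> complex) \<Rightarrow> bool" where
  "Ck_plane 0 f \<longleftrightarrow> continuous_on UNIV f"
| "Ck_plane (Suc k) f \<longleftrightarrow>
     (\<forall>z. f differentiable at z) \<and> Ck_plane k (partial_x f) \<and> Ck_plane k (partial_y f)"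

definition test_functions :: "(complex \<Rightarrow> complex) set" where
  "test_functions = {\<phi>. (\<forall>k. Ck_plane k \<phi>) \<and> compact (closure {z. \<phi> z \<noteq> 0})}"

definition locally_integrable :: "(complex \<Rightarrow> complex) \<Rightarrow> bool" where
  "locally_integrable u \<longleftrightarrow> (\<forall>K. compact K \<longrightarrow> set_integrable lebesgue K u)"

text \<open>The equation \<open>dbar u = v\<close> between the distributions given by locally integrable
  \<open>u\<close> and \<open>v\<close>. The pairing is bilinear (no complex conjugation). Local integrability
  is required because the Bochner integral of a non-integrable function is \<open>0\<close>; all elements
  of the weighted spaces above satisfy it.\<close>

definition distributional_dbar :: "(complex \<Rightarrow> complex) \<Rightarrow> (complex \<Rightarrow> complex) \<Rightarrow> bool" where
  "distributional_dbar u v \<longleftrightarrow> locally_integrable u \<and> locally_integrable v \<and>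
     (\<forall>\<phi>\<in>test_functions. - (\<integral>z. u z * dbar \<phi> z \<partial>lebesgue) = (\<integral>z. v z * \<phi> z \<partial>lebesgue))"

end

theory Submission
  imports Defs
begin

text \<open>No uniqueness theorem is needed: \<open>u\<close> is recovered pointwise by testing the equation. For smooth
  \<open>H\<close> with compact support in \<open>(0, \<infinity>)\<close>, the function \<open>\<phi> z = H (\<bar>z - b\<bar>\<^sup>2) / (z - b)\<close> is a test
  function with \<open>dbar \<phi> z = H' (\<bar>z - b\<bar>\<^sup>2)\<close>. Take \<open>H t = S (N\<^sup>2 t) - S (t / N\<^sup>2)\<close> for a smooth step
  \<open>S\<close> and let \<open>N\<close> tend to infinity, with \<open>b\<close> at distance \<open>O(1 / N)\<close> from a Lebesgue point \<open>a\<close> of \<open>u\<close>.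
  The first step yields \<open>\<pi> u a\<close>; the second is an average of \<open>u\<close> over the annulus
  \<open>N \<le> \<bar>z - b\<bar> \<le> 2 N\<close> and vanishes in the limit because \<open>u\<close> lies in the weighted space; the side
  of \<open>v\<close> converges to the integral of \<open>v z / (z - a)\<close> by dominated convergence. The kernel is
  integrable against \<open>v\<close> for almost every \<open>a\<close> by Tonelli's theorem.\<close>

section \<open>Smooth step functions on the real line\<close>

text \<open>The classical flat function \<open>exp (- 1 / t)\<close>, divided by
  \<open>t ^ k\<close>. The whole family in \<open>k\<close> is introduced because its linear span
  is closed under differentiation.\<close>

definition flat :: "nat \<Rightarrow> real \<Rightarrow> real" where
  "flat k t = (if t > 0 then inverse t ^ k / exp (inverse t) else 0)"

lemma flat_pos: "t > 0 \<Longrightarrow> flat k t > 0"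
  and flat_nonpos: "t \<le> 0 \<Longrightarrow> flat k t = 0"
  and flat_nonneg: "flat k t \<ge> 0"
  by (auto simp: flat_def)

lemma flat_tendsto_0: "(flat k \<longlongrightarrow> 0) (at 0)"
proof -
  have "((\<lambda>t::real. inverse t ^ k / exp (inverse t)) \<longlongrightarrow> 0) (at_right 0)"
    by (rule filterlim_compose[OF tendsto_power_div_exp_0 filterlim_inverse_at_top_right])
  hence "(flat k \<longlongrightarrow> 0) (at_right 0)"
    by (rule Lim_transform_eventually) (auto simp: eventually_at_filter flat_def)
  moreover have "(flat k \<longlongrightarrow> 0) (at_left 0)"
    by (rule Lim_transform_eventually[OF tendsto_const]) (auto simp: eventually_at_filter flat_def)
  ultimately show ?thesis
    by (simp add: filterlim_split_at)
qed

lemma DERIV_flat: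
  "(flat k has_real_derivative flat (k + 2) t - real k * flat (k + 1) t) (at t)"
proof -
  consider "t > 0" | "t < 0" | "t = 0" by linarith
  thus ?thesis
  proof cases
    case 1
    have "((\<lambda>t. inverse t ^ k / exp (inverse t)) has_real_derivative flat (k + 2) t - real k * flat (k + 1) t) (at t)"
      using 1
      by (auto intro!: derivative_eq_intros simp: flat_def field_simps power2_eq_square power_eq_if[of t k])
    thus ?thesis
      by (rule has_field_derivative_transform_within_open[where S="{0<..}"]) (use 1 in \<open>auto simp: flat_def\<close>)
  next
    case 2
    have "((\<lambda>t. 0) has_real_derivative flat (k + 2) t - real k * flat (k + 1) t) (at t)"
      using 2 by (auto simp: flat_def)
    thus ?thesis
      by (rule has_field_derivative_transform_within_open[where S="{..<0}"]) (use 2 in \<open>auto simp: flat_def\<close>)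
  next
    case 3
    \<comment> \<open>The difference quotient at the origin is again a member of the family,
      \<open>flat (k + 1) h\<close>, so its limit is already known.\<close>
    have "((\<lambda>h. flat k h / h) \<longlongrightarrow> 0) (at 0)"
      using flat_tendsto_0[of "k+1"]
      by (rule Lim_transform_eventually) (auto simp: flat_def field_simps)
    thus ?thesis using 3
      by (simp add: has_field_derivative_iff flat_def)
  qed
qed

text \<open>Every rule below is compatible with differentiation, so that membership already gives
  derivatives of all orders.\<close>

inductive smooth :: "(real \<Rightarrow> real) \<Rightarrow> bool" where
  smooth_const: "smooth (\<lambda>t. c)"
| smooth_ident: "smooth (\<lambda>t. t)"
| smooth_add: "smooth f \<Longrightarrow> smooth g \<Longrightarrow> smooth (\<lambda>t. f t + g t)"
| smooth_mult: "smooth f \<Longrightarrow> smooth g \<Longrightarrow> smooth (\<lambda>t. f t * g t)"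
| smooth_inverse: "smooth f \<Longrightarrow> (\<And>t. f t \<noteq> 0) \<Longrightarrow> smooth (\<lambda>t. inverse (f t))"
| smooth_flat: "smooth (flat k)"
| smooth_affine: "smooth f \<Longrightarrow> smooth (\<lambda>t. f (a * t + b))"

lemma smooth_diff: "smooth f \<Longrightarrow> smooth g \<Longrightarrow> smooth (\<lambda>t. f t - g t)"
  using smooth_add[OF _ smooth_mult[OF smooth_const[of "-1"]], of f g] by simp

lemma smooth_derivative:
  assumes "smooth f"
  obtains f' where "smooth f'" "\<And>t. (f has_real_derivative f' t) (at t)"
proof -
  from assms have "\<exists>f'. smooth f' \<and> (\<forall>t. (f has_real_derivative f' t) (at t))"
  proof induction
    case (smooth_const c)
    show ?case by (rule exI[of _ "\<lambda>t. 0"]) (auto intro: smooth.smooth_const)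
  next
    case smooth_ident
    show ?case by (rule exI[of _ "\<lambda>t. 1"]) (auto intro: smooth.smooth_const)
  next
    case (smooth_add f g)
    then obtain f' g' where "smooth f'" "smooth g'" "\<And>t. (f has_real_derivative f' t) (at t)"
      "\<And>t. (g has_real_derivative g' t) (at t)" by blast
    thus ?case by (intro exI[of _ "\<lambda>t. f' t + g' t"]) (auto intro: smooth.smooth_add DERIV_add)
  next
    case (smooth_mult f g)
    then obtain f' g' where "smooth f'" "smooth g'" "\<And>t. (f has_real_derivative f' t) (at t)"
      "\<And>t. (g has_real_derivative g' t) (at t)" by blast
    thus ?case using smooth_mult
      by (intro exI[of _ "\<lambda>t. f t * g' t + f' t * g t"])
        (auto intro!: smooth.smooth_add smooth.smooth_mult derivative_eq_intros)
  next
    case (smooth_inverse f)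
    then obtain f' where "smooth f'" "\<And>t. (f has_real_derivative f' t) (at t)" by blast
    \<comment> \<open>The derivative is written as \<open>-1\<close> times a product because the
      closure rules offer products and constants, but neither negation nor squares.\<close>
    moreover from this have "((\<lambda>t. inverse (f t)) has_real_derivative -1 * (inverse (f t) * f' t * inverse (f t))) (at t)" for t
      using smooth_inverse by (auto intro!: derivative_eq_intros)
    moreover have "smooth (\<lambda>t. -1 * (inverse (f t) * f' t * inverse (f t)))"
      using \<open>smooth f'\<close> smooth_inverse by (intro smooth.intros)
    ultimately show ?case by blast
  next
    case (smooth_flat k)
    show ?case
      by (intro exI[of _ "\<lambda>t. flat (k + 2) t - real k * flat (k + 1) t"])
        (intro conjI allI smooth_diff smooth.intros DERIV_flat)
  next
    case (smooth_affine f a b)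
    then obtain f' where f': "smooth f'" "\<And>t. (f has_real_derivative f' t) (at t)" by blast
    have "((\<lambda>t. f (a * t + b)) has_real_derivative f' (a * t + b) * a) (at t)" for t
      by (rule DERIV_chain2[OF f'(2)]) (auto intro!: derivative_eq_intros)
    thus ?case using f'
      by (intro exI[of _ "\<lambda>t. f' (a * t + b) * a"]) (auto intro!: smooth.intros)
  qed
  thus ?thesis using that by blast
qed

lemma smooth_continuous: "smooth f \<Longrightarrow> continuous_on UNIV f"
  by (meson smooth_derivative DERIV_isCont continuous_at_imp_continuous_on)

text \<open>The usual quotient \<open>p / (p + q)\<close>, where \<open>p\<close> lives on
  \<open>t > 1\<close> and \<open>q\<close> on \<open>t < 2\<close>, so the denominator never
  vanishes. Its derivative is a bump on \<open>{1..2}\<close> of total mass 1, which later acts as a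
  radial weight.\<close>

lemma smooth_step:
  obtains S S' where "smooth S" "smooth S'" "\<And>t. (S has_real_derivative S' t) (at t)"
    "\<And>t. t \<le> 1 \<Longrightarrow> S t = 0" "\<And>t. t \<ge> 2 \<Longrightarrow> S t = 1" "\<And>t. 0 \<le> S t" "\<And>t. S t \<le> 1"
    "\<And>t. t \<notin> {1..2} \<Longrightarrow> S' t = 0"
proof -
  define p q :: "real \<Rightarrow> real" where "p t = flat 0 (1 * t + -1)" and "q t = flat 0 (-1 * t + 2)" for t
  have pq: "smooth p" "smooth q" unfolding p_def q_def by (intro smooth_affine smooth_flat)+
  have pos: "p t + q t > 0" for t
  proof (cases "t > 1")
    case True
    thus ?thesis by (auto simp: p_def q_def intro!: add_pos_nonneg flat_pos flat_nonneg)
  next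
    case False
    thus ?thesis by (auto simp: p_def q_def intro!: add_nonneg_pos flat_pos flat_nonneg)
  qed
  have nn: "p t \<ge> 0" "q t \<ge> 0" for t by (auto simp: p_def q_def flat_nonneg)
  define S where "S t = p t * inverse (p t + q t)" for t
  have S: "smooth S" unfolding S_def
    using pos by (intro smooth.intros pq) (simp add: less_imp_neq[symmetric])
  obtain S' where S': "smooth S'" "\<And>t. (S has_real_derivative S' t) (at t)"
    using smooth_derivative[OF S] by blast
  have 1: "S t = 0" if "t \<le> 1" for t using that by (simp add: S_def p_def flat_nonpos)
  have 2: "S t = 1" if "t \<ge> 2" for t
    using that pos[of t] by (simp add: S_def q_def flat_nonpos)
  have 3: "0 \<le> S t" "S t \<le> 1" for t
    using nn[of t] pos[of t] by (auto simp: S_def field_simps)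
  have 4: "S' t = 0" if "t \<notin> {1..2}" for t
  proof -
    from that consider "t < 1" | "t > 2" by fastforce
    thus ?thesis
    proof cases
      case 1
      have "(S has_real_derivative 0) (at t)"
        by (rule has_field_derivative_transform_within_open[OF DERIV_const[of 0], where S="{..<1}"])
          (use 1 \<open>\<And>t. t \<le> 1 \<Longrightarrow> S t = 0\<close> in auto)
      thus ?thesis using S' DERIV_unique by blast
    next
      case 2
      have "(S has_real_derivative 0) (at t)"
        by (rule has_field_derivative_transform_within_open[OF DERIV_const[of 1], where S="{2<..}"])
          (use 2 \<open>\<And>t. t \<ge> 2 \<Longrightarrow> S t = 1\<close> in auto)
      thus ?thesis using S' DERIV_unique by blast
    qed
  qed
  show ?thesis by (rule that[OF S S' 1 2 3 4])
qed


section \<open>Smooth functions on the plane and radial test functions\<close>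

text \<open>These generators suffice for \<open>cnj (z - b) * g (|z - b|^2)\<close>, the form that
  the test function takes. The class is closed under partial derivatives: a radial generator yields
  \<open>h'\<close> of the same argument times an affine function of \<open>Re z\<close> and
  \<open>Im z\<close>.\<close>

inductive smooth_plane :: "(complex \<Rightarrow> complex) \<Rightarrow> bool" where
  smooth_plane_const: "smooth_plane (\<lambda>z. c)"
| smooth_plane_Re: "smooth_plane (\<lambda>z. complex_of_real (Re z))"
| smooth_plane_Im: "smooth_plane (\<lambda>z. complex_of_real (Im z))"
| smooth_plane_add: "smooth_plane f \<Longrightarrow> smooth_plane g \<Longrightarrow> smooth_plane (\<lambda>z. f z + g z)"
| smooth_plane_mult: "smooth_plane f \<Longrightarrow> smooth_plane g \<Longrightarrow> smooth_plane (\<lambda>z. f z * g z)"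
| smooth_plane_radial: "smooth h \<Longrightarrow> smooth_plane (\<lambda>z. complex_of_real (h ((cmod (z - b))\<^sup>2)))"

text \<open>The total derivative is recorded, not only the two partials, because
  \<open>Ck_plane\<close> asks for real differentiability at every order.\<close>

lemma smooth_plane_partials:
  assumes "smooth_plane f"
  obtains fx fy where "smooth_plane fx" "smooth_plane fy"
    "\<And>z. (f has_derivative (\<lambda>h. of_real (Re h) * fx z + of_real (Im h) * fy z)) (at z)"
proof -
  from assms have "\<exists>fx fy. smooth_plane fx \<and> smooth_plane fy \<and>
    (\<forall>z. (f has_derivative (\<lambda>h. of_real (Re h) * fx z + of_real (Im h) * fy z)) (at z))"
  proof induction
    case (smooth_plane_const c)
    show ?case by (rule exI[of _ "\<lambda>z. 0"], rule exI[of _ "\<lambda>z. 0"])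
        (auto intro!: smooth_plane.intros)
  next
    case smooth_plane_Re
    show ?case by (rule exI[of _ "\<lambda>z. 1"], rule exI[of _ "\<lambda>z. 0"])
        (auto intro!: smooth_plane.intros derivative_eq_intros)
  next
    case smooth_plane_Im
    show ?case by (rule exI[of _ "\<lambda>z. 0"], rule exI[of _ "\<lambda>z. 1"])
        (auto intro!: smooth_plane.intros derivative_eq_intros)
  next
    case (smooth_plane_add f g)
    then obtain fx fy gx gy where "smooth_plane fx" "smooth_plane fy" "smooth_plane gx" "smooth_plane gy"
     "\<And>z. (f has_derivative (\<lambda>h. of_real (Re h) * fx z + of_real (Im h) * fy z)) (at z)"
     "\<And>z. (g has_derivative (\<lambda>h. of_real (Re h) * gx z + of_real (Im h) * gy z)) (at z)" by blast
    thus ?case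
      by (intro exI[of _ "\<lambda>z. fx z + gx z"] exI[of _ "\<lambda>z. fy z + gy z"])
        (auto intro!: smooth_plane.intros derivative_eq_intros simp: algebra_simps)
  next
    case (smooth_plane_mult f g)
    then obtain fx fy gx gy where "smooth_plane fx" "smooth_plane fy" "smooth_plane gx" "smooth_plane gy"
     "\<And>z. (f has_derivative (\<lambda>h. of_real (Re h) * fx z + of_real (Im h) * fy z)) (at z)"
     "\<And>z. (g has_derivative (\<lambda>h. of_real (Re h) * gx z + of_real (Im h) * gy z)) (at z)" by blast
    thus ?case using smooth_plane_mult
      by (intro exI[of _ "\<lambda>z. f z * gx z + fx z * g z"] exI[of _ "\<lambda>z. f z * gy z + fy z * g z"])
        (auto intro!: smooth_plane.intros derivative_eq_intros simp: algebra_simps)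
  next
    case (smooth_plane_radial h b)
    obtain h' where h': "smooth h'" "\<And>t. (h has_real_derivative h' t) (at t)"
      using smooth_derivative[OF smooth_plane_radial] by blast
    have d: "((\<lambda>z. complex_of_real (h ((cmod (z - b))\<^sup>2))) has_derivative
       (\<lambda>k. of_real (Re k) * (of_real (h' ((cmod (z - b))\<^sup>2)) * (2 * (of_real (Re z) + - of_real (Re b))))
          + of_real (Im k) * (of_real (h' ((cmod (z - b))\<^sup>2)) * (2 * (of_real (Im z) + - of_real (Im b)))))) (at z)" for z
    proof -
      \<comment> \<open>As a sum of squares the squared modulus is differentiable by the polynomial
        rules everywhere, including at \<open>b\<close>, where \<open>cmod (z - b)\<close> itself is
        not.\<close>
      have "((\<lambda>z. h ((Re (z - b))\<^sup>2 + (Im (z - b))\<^sup>2)) has_derivative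
          (\<lambda>k. (2 * Re (z - b) * Re k + 2 * Im (z - b) * Im k) * h' ((Re (z - b))\<^sup>2 + (Im (z - b))\<^sup>2))) (at z)"
        by (rule has_derivative_compose[of "\<lambda>z. (Re (z - b))\<^sup>2 + (Im (z - b))\<^sup>2" _ z UNIV h "\<lambda>x. x * h' ((Re (z - b))\<^sup>2 + (Im (z - b))\<^sup>2)"])
          (auto simp: algebra_simps intro!: derivative_eq_intros h'(2)[unfolded has_field_derivative_def, THEN has_derivative_eq_rhs])
      hence "((\<lambda>z. complex_of_real (h ((cmod (z - b))\<^sup>2))) has_derivative
          (\<lambda>k. complex_of_real ((2 * Re (z - b) * Re k + 2 * Im (z - b) * Im k) * h' ((cmod (z - b))\<^sup>2)))) (at z)"
        unfolding cmod_power2 by (rule has_derivative_of_real)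
      thus ?thesis by (rule has_derivative_eq_rhs) (auto simp: algebra_simps)
    qed
    have s: "smooth_plane (\<lambda>z. of_real (h' ((cmod (z - b))\<^sup>2)) * (2 * (of_real (Re z) + - of_real (Re b))))"
      "smooth_plane (\<lambda>z. of_real (h' ((cmod (z - b))\<^sup>2)) * (2 * (of_real (Im z) + - of_real (Im b))))"
      by (intro smooth_plane.intros h')+
    show ?case using d s by blast
  qed
  thus ?thesis using that by blast
qed

lemma has_derivative_partials:
  assumes "(f has_derivative D) (at z)"
  shows "partial_x f z = D 1" "partial_y f z = D \<i>"
proof -
  interpret bounded_linear D using assms by (rule has_derivative_bounded_linear)
  \<comment> \<open>A general direction \<open>c\<close> treats both partials at once; they are the
    cases 1 and \<open>\<i>\<close>.\<close>
  have "((\<lambda>t. f (z + c * of_real t)) has_vector_derivative D c) (at 0)" for c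
  proof -
    have "((\<lambda>t. z + c * complex_of_real t) has_derivative (\<lambda>t. c * of_real t)) (at 0)"
      by (auto intro!: derivative_eq_intros)
    from has_derivative_compose[OF this, of f D] assms
    have "((\<lambda>t. f (z + c * of_real t)) has_derivative (\<lambda>t. D (c * of_real t))) (at 0)" by simp
    moreover have "D (c * of_real t) = t *\<^sub>R D c" for t
      using scaleR[of t c] by (simp add: scaleR_conv_of_real mult.commute)
    ultimately show ?thesis by (simp add: has_vector_derivative_def)
  qed
  from this[of 1] this[of \<i>] show "partial_x f z = D 1" "partial_y f z = D \<i>"
    by (auto simp: partial_x_def partial_y_def vector_derivative_at)
qed

lemma smooth_plane_Ck:
  "smooth_plane f \<Longrightarrow> Ck_plane k f"
proof (induction k arbitrary: f)
  case 0
  then obtain fx fy where "\<And>z. (f has_derivative (\<lambda>h. of_real (Re h) * fx z + of_real (Im h) * fy z)) (at z)"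
    using smooth_plane_partials by blast
  thus ?case by (auto intro!: continuous_at_imp_continuous_on has_derivative_continuous)
next
  case (Suc k)
  then obtain fx fy where f: "smooth_plane fx" "smooth_plane fy"
    "\<And>z. (f has_derivative (\<lambda>h. of_real (Re h) * fx z + of_real (Im h) * fy z)) (at z)"
    using smooth_plane_partials by blast
  have "partial_x f = fx" "partial_y f = fy"
    using has_derivative_partials[OF f(3)] by auto
  thus ?case using f Suc by (auto simp: differentiable_def)
qed

lemma has_derivative_dbar:
  assumes "(f has_derivative D) (at z)"
  shows "dbar f z = (D 1 + \<i> * D \<i>) / 2"
  using has_derivative_partials[OF assms] by (simp add: dbar_def)

text \<open>The factor \<open>t / (t\<^sup>2 + flat 0 (c - t))\<close> is smooth on the whole line and equals \<open>1 / t\<close>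
  where \<open>H\<close> does not vanish.\<close>

lemma radial_test_function:
  fixes H H' :: "real \<Rightarrow> real" and b :: complex
  assumes "smooth H" "\<And>t. (H has_real_derivative H' t) (at t)"
    and "c > 0" "\<And>t. t \<le> c \<Longrightarrow> H t = 0" "\<And>t. t \<ge> R \<Longrightarrow> H t = 0"
  defines "\<phi> \<equiv> \<lambda>z. of_real (H ((cmod (z - b))\<^sup>2)) / (z - b)"
  shows "\<phi> \<in> test_functions" "dbar \<phi> z = of_real (H' ((cmod (z - b))\<^sup>2))"
proof -
  define m where "m t = t * t + flat 0 (-1 * t + c)" for t
  define g where "g t = H t * (t * inverse (m t))" for t
  have m_pos: "m t > 0" for t
  proof (cases "t = 0")
    case True thus ?thesis using \<open>c > 0\<close> by (simp add: m_def flat_pos)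
  next
    case False
    hence "t * t > 0" using not_real_square_gt_zero by blast
    thus ?thesis using flat_nonneg[of 0 "-1*t+c"] by (simp add: m_def)
  qed
  have "smooth g" unfolding g_def m_def
    using m_pos[unfolded m_def] by (intro smooth.intros assms) (simp add: less_imp_neq[symmetric])
  \<comment> \<open>For \<open>t \<le> c\<close> both sides vanish; beyond \<open>c\<close> the flat
    term is 0 and \<open>m t\<close> is exactly \<open>t * t\<close>.\<close>
  have tg: "t * g t = H t" for t
    using assms(3) assms(4)[of t] by (cases "t \<le> c") (auto simp: g_def m_def flat_nonpos field_simps)
  obtain g' where g': "\<And>t. (g has_real_derivative g' t) (at t)"
    using smooth_derivative[OF \<open>smooth g\<close>] by blast
  have H': "H' t = g t + t * g' t" for t
  proof -
    have "((\<lambda>t. t * g t) has_real_derivative g t + t * g' t) (at t)"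
      by (auto intro!: derivative_eq_intros g')
    moreover have "(\<lambda>t. t * g t) = H" using tg by auto
    ultimately show ?thesis using assms(2) DERIV_unique by metis
  qed
  \<comment> \<open>The singular factor \<open>1 / (z - b)\<close> equals the conjugate over the
    squared modulus, and the latter is absorbed into \<open>g\<close>. At \<open>z = b\<close>
    division by zero gives 0, in agreement with the vanishing conjugate.\<close>
  have phi: "\<phi> z = cnj (z - b) * of_real (g ((cmod (z - b))\<^sup>2))" for z
  proof (cases "z = b")
    case False
    have "complex_of_real (H ((cmod (z - b))\<^sup>2)) = (z - b) * cnj (z - b) * of_real (g ((cmod (z - b))\<^sup>2))"
      unfolding complex_norm_square[symmetric] of_real_mult[symmetric] tg ..
    thus ?thesis using False by (simp add: \<phi>_def)
  qed (simp add: \<phi>_def)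
  have "smooth_plane (\<lambda>z. ((of_real (Re z) + (-\<i>) * of_real (Im z)) + - cnj b) * of_real (g ((cmod (z - b))\<^sup>2)))"
    by (intro smooth_plane.intros \<open>smooth g\<close>)
  also have "(\<lambda>z. ((of_real (Re z) + (-\<i>) * of_real (Im z)) + - cnj b) * of_real (g ((cmod (z - b))\<^sup>2))) = \<phi>"
    by (auto simp: phi complex_eq_iff)
  finally have sm: "smooth_plane \<phi>" .
  have "{z. \<phi> z \<noteq> 0} \<subseteq> cball b (sqrt R)"
  proof
    fix z assume "z \<in> {z. \<phi> z \<noteq> 0}"
    hence "(cmod (z - b))\<^sup>2 < R" using assms(5)[of "(cmod (z - b))\<^sup>2"] by (force simp: \<phi>_def)
    thus "z \<in> cball b (sqrt R)"
      by (simp add: dist_norm norm_minus_commute real_le_rsqrt)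
  qed
  hence "compact (closure {z. \<phi> z \<noteq> 0})"
    by (meson bounded_subset bounded_cball compact_closure)
  thus "\<phi> \<in> test_functions" using sm smooth_plane_Ck by (auto simp: test_functions_def)
  have *: "((\<lambda>z. g ((Re (z - b))\<^sup>2 + (Im (z - b))\<^sup>2)) has_derivative
          (\<lambda>k. (2 * Re (z - b) * Re k + 2 * Im (z - b) * Im k) * g' ((Re (z - b))\<^sup>2 + (Im (z - b))\<^sup>2))) (at z)"
    by (rule has_derivative_compose[of "\<lambda>z. (Re (z - b))\<^sup>2 + (Im (z - b))\<^sup>2" _ z UNIV g "\<lambda>x. x * g' ((Re (z - b))\<^sup>2 + (Im (z - b))\<^sup>2)"])
      (auto simp: algebra_simps intro!: derivative_eq_intros g'[unfolded has_field_derivative_def, THEN has_derivative_eq_rhs])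
  let ?T = "(Re (z - b))\<^sup>2 + (Im (z - b))\<^sup>2"
  have deriv: "((\<lambda>z. cnj (z - b) * of_real (g ((Re (z - b))\<^sup>2 + (Im (z - b))\<^sup>2))) has_derivative
     (\<lambda>k. cnj (z - b) * of_real ((2 * Re (z - b) * Re k + 2 * Im (z - b) * Im k) * g' ?T) + cnj k * of_real (g ?T))) (at z)"
    by (rule has_derivative_mult[OF _ has_derivative_of_real[OF *]]) (auto intro!: derivative_eq_intros)
  \<comment> \<open>With \<open>w = z - b\<close>, \<open>q = g\<close> and \<open>p = g'\<close>,
    this is the computation of dbar of \<open>cnj w * g (|w|^2)\<close>. The result
    \<open>g + t * g'\<close> at \<open>t = |w|^2\<close> is the derivative of
    \<open>t * g t = H t\<close>.\<close>
  have alg: "(cnj w * of_real (2 * Re w * p) + of_real q + \<i> * (cnj w * of_real (2 * Im w * p) + - \<i> * of_real q)) / 2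
      = of_real (q + ((Re w)\<^sup>2 + (Im w)\<^sup>2) * p)" for w p q
    by (simp add: complex_eq_iff power2_eq_square field_simps)
  note deriv
  moreover have "(\<lambda>z. cnj (z - b) * of_real (g ((Re (z - b))\<^sup>2 + (Im (z - b))\<^sup>2))) = \<phi>"
    by (auto simp: phi cmod_power2)
  ultimately have "dbar \<phi> z = (cnj (z - b) * of_real (2 * Re (z - b) * g' ?T) + of_real (g ?T)
     + \<i> * (cnj (z - b) * of_real (2 * Im (z - b) * g' ?T) + - \<i> * of_real (g ?T))) / 2"
    by (subst has_derivative_dbar) auto
  also have "\<dots> = of_real (g ?T + ?T * g' ?T)"
    by (rule alg)
  finally show "dbar \<phi> z = of_real (H' ((cmod (z - b))\<^sup>2))"
    by (simp add: H' cmod_power2)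
qed


section \<open>Integrals of radial functions\<close>

text \<open>The sign makes the measures of the half-lines \<open>{x<..}\<close> finite.\<close>

lemma distr_cmod_square:
  "distr lborel borel (\<lambda>z::complex. - (cmod z)\<^sup>2) = density lborel (\<lambda>t. ennreal (pi * indicator {..<0} t))"
proof (rule measure_eqI_lessThan)
  fix x :: real
  \<comment> \<open>The preimage of a half-line with \<open>x < 0\<close> is a disc of squared
    radius \<open>- x\<close>; otherwise it is empty.\<close>
  have distr_eq: "emeasure (distr lborel borel (\<lambda>z::complex. - (cmod z)\<^sup>2)) {x<..} = ennreal (pi * max 0 (- x))"
  proof (cases "x < 0")
    case True
    have "(\<lambda>z::complex. - (cmod z)\<^sup>2) -` {x<..} = ball 0 (sqrt (- x))"
    proof -
      have "(cmod z)\<^sup>2 < - x \<longleftrightarrow> cmod z < sqrt (- x)" for z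
        by (metis abs_norm_cancel real_sqrt_abs real_sqrt_less_iff)
      thus ?thesis by (auto simp: less_minus_iff[of x])
    qed
    thus ?thesis using True
      by (simp add: emeasure_distr emeasure_ball unit_ball_vol_2)
  next
    case False
    hence "(\<lambda>z::complex. - (cmod z)\<^sup>2) -` {x<..} = {}"
      by auto (smt (verit) zero_le_power2)
    thus ?thesis using False by (simp add: emeasure_distr)
  qed
  note distr_eq
  moreover have "emeasure (density lborel (\<lambda>t. ennreal (pi * indicator {..<0} t))) {x<..} = ennreal (pi * max 0 (- x))"
  proof -
    have "emeasure (density lborel (\<lambda>t. ennreal (pi * indicator {..<0} t))) {x<..}
        = (\<integral>\<^sup>+t. ennreal pi * indicator {x<..<0} t \<partial>lborel)"
      by (subst emeasure_density) (auto intro!: nn_integral_cong simp: indicator_def)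
    also have "\<dots> = ennreal pi * emeasure lborel {x<..<0}" by (subst nn_integral_cmult_indicator) auto
    also have "\<dots> = ennreal (pi * max 0 (- x))"
      by (cases "x \<le> 0") (auto simp: ennreal_mult'[symmetric] max_def)
    finally show ?thesis .
  qed
  ultimately show "emeasure (distr lborel borel (\<lambda>z::complex. - (cmod z)\<^sup>2)) {x<..}
      = emeasure (density lborel (\<lambda>t. ennreal (pi * indicator {..<0} t))) {x<..}" by (rule trans[OF _ sym])
  show "emeasure (distr lborel borel (\<lambda>z::complex. - (cmod z)\<^sup>2)) {x<..} < \<infinity>"
    unfolding distr_eq by simp
qed auto

text \<open>Polar coordinates in the variable \<open>t = r^2\<close>: the area element
  \<open>2 * pi * r dr\<close> becomes \<open>pi dt\<close>, so the density is constant. Translation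
  invariance removes \<open>b\<close>, and the reflection of \<open>t\<close> undoes the sign in
  \<open>distr_cmod_square\<close>.\<close>

lemma nn_integral_radial:
  fixes f :: "real \<Rightarrow> ennreal"
  assumes [measurable]: "f \<in> borel_measurable borel"
  shows "(\<integral>\<^sup>+z. f ((cmod (z - b))\<^sup>2) \<partial>lborel) = ennreal pi * (\<integral>\<^sup>+t. indicator {0<..} t * f t \<partial>lborel)"
proof -
  have "(\<integral>\<^sup>+z. f ((cmod (z - b))\<^sup>2) \<partial>lborel) = (\<integral>\<^sup>+z. f ((cmod (z - b))\<^sup>2) \<partial>distr lborel borel ((+) b))"
    by (simp add: lborel_distr_plus)
  also have "\<dots> = (\<integral>\<^sup>+z. f (- (- (cmod z)\<^sup>2)) \<partial>lborel)"
    by (subst nn_integral_distr) auto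
  also have "\<dots> = (\<integral>\<^sup>+t. f (- t) \<partial>distr lborel borel (\<lambda>z::complex. - (cmod z)\<^sup>2))"
    by (subst nn_integral_distr) auto
  also have "\<dots> = (\<integral>\<^sup>+t. ennreal pi * (indicator {..<0} t * f (- t)) \<partial>lborel)"
    unfolding distr_cmod_square
    by (subst nn_integral_density) (auto intro!: nn_integral_cong simp: indicator_def)
  also have "\<dots> = ennreal pi * (\<integral>\<^sup>+t. indicator {..<0} t * f (- t) \<partial>lborel)"
    by (rule nn_integral_cmult) auto
  also have "(\<integral>\<^sup>+t. indicator {..<0} t * f (- t) \<partial>lborel) = (\<integral>\<^sup>+t. indicator {0<..} t * f t \<partial>lborel)"
    by (subst nn_integral_real_affine[where c="-1" and t=0]) (auto intro!: nn_integral_cong simp: indicator_def)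
  finally show ?thesis .
qed

lemma integral_radial:
  fixes f :: "real \<Rightarrow> real"
  assumes [measurable]: "f \<in> borel_measurable borel"
  shows "(\<integral>z. f ((cmod (z - b))\<^sup>2) \<partial>lborel) = pi * (\<integral>t. indicator {0<..} t * f t \<partial>lborel)"
proof -
  have "(\<integral>z. f ((cmod (z - b))\<^sup>2) \<partial>lborel) = (\<integral>z. f ((cmod (z - b))\<^sup>2) \<partial>distr lborel borel ((+) b))"
    by (simp add: lborel_distr_plus)
  also have "\<dots> = (\<integral>z. f (- (- (cmod z)\<^sup>2)) \<partial>lborel)"
    by (subst integral_distr) auto
  also have "\<dots> = (\<integral>t. f (- t) \<partial>distr lborel borel (\<lambda>z::complex. - (cmod z)\<^sup>2))"
    by (subst integral_distr) auto
  also have "\<dots> = (\<integral>t. pi * (indicator {..<0} t * f (- t)) \<partial>lborel)"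
    unfolding distr_cmod_square
    by (subst integral_density) (auto simp: mult.assoc)
  also have "\<dots> = pi * (\<integral>t. indicator {..<0} t * f (- t) \<partial>lborel)"
    by (rule integral_mult_right_zero)
  also have "(\<integral>t. indicator {..<0} t * f (- t) \<partial>lborel) = (\<integral>t. indicator {0<..} t * f t \<partial>lborel)"
    by (subst lborel_integral_real_affine[where c="-1" and t=0]) (auto intro!: Bochner_Integration.integral_cong simp: indicator_def)
  finally show ?thesis .
qed

text \<open>In the variable \<open>t = r^2\<close> the integral over the plane reduces to the
  fundamental theorem of calculus on \<open>{p..q}\<close>. This is the source of the factor
  \<open>pi\<close> in the representation formula.\<close>

lemma integral_radial_derivative:
  fixes F F' :: "real \<Rightarrow> real"
  assumes "\<And>t. (F has_real_derivative F' t) (at t)" "continuous_on UNIV F'"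
    and "0 < p" "p \<le> q" "\<And>t. t \<notin> {p..q} \<Longrightarrow> F' t = 0"
  shows "(\<integral>z. F' ((cmod (z - b))\<^sup>2) \<partial>lebesgue) = pi * (F q - F p)"
proof -
  have [measurable]: "F' \<in> borel_measurable borel"
    by (rule borel_measurable_continuous_onI) fact
  have "(\<integral>z. F' ((cmod (z - b))\<^sup>2) \<partial>lebesgue) = (\<integral>z. F' ((cmod (z - b))\<^sup>2) \<partial>lborel)"
    by (rule integral_completion) auto
  also have "\<dots> = pi * (\<integral>t. indicator {0<..} t * F' t \<partial>lborel)"
    by (rule integral_radial) auto
  also have "(\<lambda>t. indicator {0<..} t * F' t) = (\<lambda>t. F' t * indicator {p..q} t)"
  proof
    fix t show "indicator {0<..} t * F' t = F' t * indicator {p..q} t"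
      using \<open>0 < p\<close> assms(5)[of t] by (cases "t \<in> {p..q}") auto
  qed
  also have "(\<integral>t. F' t * indicator {p..q} t \<partial>lborel) = F q - F p"
    using assms by (intro integral_FTC_Icc_real) (auto simp: continuous_on_eq_continuous_at)
  finally show ?thesis .
qed

text \<open>In the variable \<open>t = r^2\<close> the kernel becomes \<open>t powr (-1/2)\<close>
  on the unit interval, an integrable singularity.\<close>

lemma nn_integral_near_kernel:
  "(\<integral>\<^sup>+z. ennreal (indicator {..<1} (cmod (z - w)) / cmod (z - w)) \<partial>lborel) < \<infinity>"
proof -
  have "(\<integral>\<^sup>+z. ennreal (indicator {..<1} (cmod (z - w)) / cmod (z - w)) \<partial>lborel)
      = (\<integral>\<^sup>+z. ennreal (indicator {..<1} (sqrt ((cmod (z - w))\<^sup>2)) / sqrt ((cmod (z - w))\<^sup>2)) \<partial>lborel)"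
    by simp
  also have "\<dots> = ennreal pi * (\<integral>\<^sup>+t. indicator {0<..} t * ennreal (indicator {..<1} (sqrt t) / sqrt t) \<partial>lborel)"
    by (rule nn_integral_radial) measurable
  finally have eq: "(\<integral>\<^sup>+z. ennreal (indicator {..<1} (cmod (z - w)) / cmod (z - w)) \<partial>lborel)
      = ennreal pi * (\<integral>\<^sup>+t. indicator {0<..} t * ennreal (indicator {..<1} (sqrt t) / sqrt t) \<partial>lborel)" .
  have "(\<integral>\<^sup>+t. indicator {0<..} t * ennreal (indicator {..<1} (sqrt t) / sqrt t) \<partial>lborel)
     \<le> (\<integral>\<^sup>+t. ennreal (norm (indicator {0..1} t *\<^sub>R (t powr (-1/2) :: real))) \<partial>lborel)"
  proof (rule nn_integral_mono)
    fix t :: real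
    show "indicator {0<..} t * ennreal (indicator {..<1} (sqrt t) / sqrt t)
        \<le> ennreal (norm (indicator {0..1} t *\<^sub>R (t powr (-1/2) :: real)))"
    proof (cases "0 < t \<and> t < 1")
      case True
      hence "t powr (-1/2) = 1 / sqrt t"
        by (metis inverse_eq_divide less_imp_le minus_divide_left powr_half_sqrt powr_minus)
      thus ?thesis using True by simp
    qed (auto simp: indicator_def)
  qed
  also have "\<dots> = (\<integral>\<^sup>+t. ennreal (norm (indicator {0..1} t *\<^sub>R (t powr (-1/2) :: real))) \<partial>lebesgue)"
    by (simp add: nn_integral_completion)
  also have "\<dots> < \<infinity>"
  proof -
    have "(\<lambda>t::real. t powr (-1/2)) absolutely_integrable_on {0..1}"
      by (intro nonnegative_absolutely_integrable_1 integrable_on_powr_from_0) auto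
    thus ?thesis unfolding set_integrable_def integrable_iff_bounded by auto
  qed
  finally show ?thesis unfolding eq by (simp add: ennreal_mult_less_top)
qed

text \<open>This is the square integrability of the bracket to the power -2, which controls the
  Cauchy kernel far from its pole. Radially the integrand is \<open>inverse ((1 + t)^2)\<close>,
  with antiderivative \<open>- inverse (1 + t)\<close>.\<close>

lemma integrable_bracket_power:
  "integrable lebesgue (\<lambda>w. inverse ((1 + (cmod w)\<^sup>2)\<^sup>2))"
proof -
  have "(\<integral>\<^sup>+w. ennreal (inverse ((1 + (cmod (w - 0))\<^sup>2)\<^sup>2)) \<partial>lborel)
     = ennreal pi * (\<integral>\<^sup>+t. indicator {0<..} t * ennreal (inverse ((1 + t)\<^sup>2)) \<partial>lborel)"
    by (rule nn_integral_radial) measurable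
  hence eq: "(\<integral>\<^sup>+w. ennreal (inverse ((1 + (cmod w)\<^sup>2)\<^sup>2)) \<partial>lborel)
     = ennreal pi * (\<integral>\<^sup>+t. indicator {0<..} t * ennreal (inverse ((1 + t)\<^sup>2)) \<partial>lborel)" by simp
  have "(\<integral>\<^sup>+t. indicator {0<..} t * ennreal (inverse ((1 + t)\<^sup>2)) \<partial>lborel)
      \<le> (\<integral>\<^sup>+t. ennreal (inverse ((1 + t)\<^sup>2)) * indicator {0..} t \<partial>lborel)"
    by (intro nn_integral_mono) (auto simp: indicator_def)
  also have "\<dots> = ennreal (0 - (- inverse (1 + 0)))"
  proof (rule nn_integral_FTC_atLeast)
    show "((\<lambda>t. - inverse (1 + t)) \<longlongrightarrow> 0) (at_top :: real filter)"
      using tendsto_minus[OF tendsto_inverse_0_at_top[OF filterlim_tendsto_add_at_top[OF tendsto_const filterlim_ident]], of "1::real"]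
      by simp
  qed (auto intro!: derivative_eq_intros simp: power2_eq_square)
  also have "\<dots> < \<infinity>" by simp
  finally have "(\<integral>\<^sup>+w. ennreal (inverse ((1 + (cmod w)\<^sup>2)\<^sup>2)) \<partial>lborel) < \<infinity>"
    unfolding eq by (simp add: ennreal_mult_less_top)
  hence "integrable lborel (\<lambda>w. inverse ((1 + (cmod w)\<^sup>2)\<^sup>2))"
    by (intro integrableI_nonneg) auto
  thus ?thesis by (subst integrable_completion) auto
qed


section \<open>Integrability of the Cauchy kernel against v\<close>

text \<open>Takes the place of the Cauchy-Schwarz inequality: a product of two square integrable
  functions gets an integrable pointwise majorant.\<close>

lemma mult_le_sum_squares:
  fixes x y :: real
  assumes "x \<ge> 0" "y \<ge> 0"
  shows "x * y \<le> x\<^sup>2 + y\<^sup>2"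
  using sum_squares_bound[of x y] mult_nonneg_nonneg[OF assms] by linarith

text \<open>The kernel is split at \<open>cmod (z - w) = 1\<close>. The near part is finite for
  almost every \<open>z\<close> by Tonelli; the far part is finite for every \<open>z\<close>, since
  one bracket comes from the weight of \<open>v\<close> and a second from the decay of the
  kernel.\<close>

lemma Cauchy_kernel_AE_integrable:
  assumes v: "v \<in> weighted_L2 (-1)" "locally_integrable v"
  shows "AE z in lebesgue. integrable lebesgue (\<lambda>w. v w / (z - w))"
proof -
  obtain V where V: "V \<in> L2_complex" "v = (\<lambda>z. of_real (japanese_bracket z powr (-1)) * V z)"
    using v(1) unfolding weighted_L2_def by auto
  have [measurable]: "V \<in> borel_measurable lebesgue" using V(1) by (simp add: L2_complex_def)
  have jb: "japanese_bracket \<in> borel_measurable lebesgue"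
    unfolding japanese_bracket_def[abs_def]
    by (intro measurable_completion) measurable
  have [measurable]: "v \<in> borel_measurable lebesgue"
    unfolding V(2) using jb by measurable
  \<comment> \<open>Tonelli is applied to Borel functions on the product, while \<open>v\<close> is
    only Lebesgue measurable; \<open>f\<close> is a Borel version of its modulus.\<close>
  obtain f where [measurable]: "f \<in> borel_measurable borel"
    and f: "AE w in lborel. ennreal (cmod (v w)) = f w"
    using completion_ex_borel_measurable[of "\<lambda>w. ennreal (cmod (v w))" lborel] by auto
  define k :: "complex \<Rightarrow> complex \<Rightarrow> ennreal"
    where "k z w = ennreal (indicator {..<1} (cmod (z - w)) / cmod (z - w))" for z w
  have k [measurable]: "(\<lambda>z. k z w) \<in> borel_measurable borel" "k z \<in> borel_measurable borel" for z w
    unfolding k_def[abs_def] by measurable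
  have [measurable]: "cball 0 r \<in> sets (borel :: complex measure)" "cball 0 r \<in> sets (lebesgue :: complex measure)" for r
    by simp_all
  have "sets (lborel \<Otimes>\<^sub>M lborel) = sets (borel \<Otimes>\<^sub>M (borel :: complex measure))"
    by (intro sets_pair_measure_cong) auto
  hence bm: "borel_measurable (lborel \<Otimes>\<^sub>M lborel) = borel_measurable (borel \<Otimes>\<^sub>M (borel :: complex measure))"
    by (rule measurable_cong_sets) simp
  have meas: "(\<lambda>(w, z). indicator (cball 0 r) w * f w * k z w) \<in> borel_measurable (lborel \<Otimes>\<^sub>M lborel)"
    "(\<lambda>(z, w). indicator (cball 0 r) w * f w * k z w) \<in> borel_measurable (lborel \<Otimes>\<^sub>M lborel)" for r
    unfolding k_def bm by measurable
  \<comment> \<open>Countably many balls share one exceptional null set. If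
    \<open>cmod z \<le> m\<close>, the unit disc about \<open>z\<close> lies in the ball of radius
    \<open>m + 1\<close>, so the truncation loses nothing near \<open>z\<close>.\<close>
  have near: "AE z in lborel. \<forall>m::nat. (\<integral>\<^sup>+w. indicator (cball 0 (real m + 1)) w * f w * k z w \<partial>lborel) \<noteq> \<infinity>"
  proof (unfold AE_all_countable, intro allI nn_integral_PInf_AE)
    fix m :: nat
    define C where "C = (\<integral>\<^sup>+z. k z 0 \<partial>lborel)"
    \<comment> \<open>By translation invariance the mass of the near kernel does not depend on
      \<open>w\<close>, so the double integral factors into \<open>C\<close> and the integral of
      \<open>f\<close> over the ball.\<close>
    have C: "(\<integral>\<^sup>+z. k z w \<partial>lborel) = C" for w
    proof -
      have "(\<integral>\<^sup>+z. k z w \<partial>lborel) = (\<integral>\<^sup>+z. k z w \<partial>distr lborel borel ((+) w))"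
        by (simp add: lborel_distr_plus)
      also have "\<dots> = C" unfolding C_def k_def by (subst nn_integral_distr) auto
      finally show ?thesis .
    qed
    have "C < \<infinity>" using nn_integral_near_kernel[of 0] by (simp add: C_def k_def)
    have "(\<integral>\<^sup>+z. \<integral>\<^sup>+w. indicator (cball 0 (real m + 1)) w * f w * k z w \<partial>lborel \<partial>lborel)
       = (\<integral>\<^sup>+w. \<integral>\<^sup>+z. indicator (cball 0 (real m + 1)) w * f w * k z w \<partial>lborel \<partial>lborel)"
      by (rule lborel_pair.Fubini'[OF meas(1)])
    also have "\<dots> = (\<integral>\<^sup>+w. indicator (cball 0 (real m + 1)) w * f w * C \<partial>lborel)"
      by (intro nn_integral_cong) (subst nn_integral_cmult, auto simp: C)
    also have "\<dots> = (\<integral>\<^sup>+w. indicator (cball 0 (real m + 1)) w * f w \<partial>lborel) * C"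
      by (rule nn_integral_multc) simp
    finally have eq: "(\<integral>\<^sup>+z. \<integral>\<^sup>+w. indicator (cball 0 (real m + 1)) w * f w * k z w \<partial>lborel \<partial>lborel)
       = (\<integral>\<^sup>+w. indicator (cball 0 (real m + 1)) w * f w \<partial>lborel) * C" .
    have "(\<integral>\<^sup>+w. indicator (cball 0 (real m + 1)) w * f w \<partial>lborel)
       = (\<integral>\<^sup>+w. ennreal (norm (indicator (cball 0 (real m + 1)) w *\<^sub>R v w)) \<partial>lborel)"
      using f by (intro nn_integral_cong_AE) (auto elim!: eventually_mono simp: indicator_def)
    also have "\<dots> < \<infinity>"
      using v(2)[unfolded locally_integrable_def, rule_format, of "cball 0 (real m + 1)"]
      by (simp add: set_integrable_def integrable_iff_bounded nn_integral_completion)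
    finally show "(\<integral>\<^sup>+z. \<integral>\<^sup>+w. indicator (cball 0 (real m + 1)) w * f w * k z w \<partial>lborel \<partial>lborel) \<noteq> \<infinity>"
      unfolding eq using \<open>C < \<infinity>\<close> by (auto simp: ennreal_mult_eq_top_iff)
  qed (rule lborel.borel_measurable_nn_integral[OF meas(2)])
  have "integrable lebesgue (\<lambda>w. v w / (z - w))"
    if z: "\<forall>m::nat. (\<integral>\<^sup>+w. indicator (cball 0 (real m + 1)) w * f w * k z w \<partial>lborel) \<noteq> \<infinity>" for z
  proof -
    obtain m :: nat where m: "cmod z \<le> real m" using real_arch_simple by blast
    \<comment> \<open>The factor \<open>2 + cmod z\<close> comes from comparing the bracket of
      \<open>w\<close> with \<open>cmod (z - w) \<ge> 1\<close>. The sum is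
      \<open>mult_le_sum_squares\<close> applied to \<open>cmod (V w)\<close> and the inverse
      squared bracket.\<close>
    define A where "A w = (2 + cmod z) * ((cmod (V w))\<^sup>2 + inverse ((1 + (cmod w)\<^sup>2)\<^sup>2))" for w
    have A: "integrable lebesgue A" unfolding A_def
      using V(1) integrable_bracket_power by (auto simp: L2_complex_def)
    have A0: "A w \<ge> 0" for w by (simp add: A_def)
    have bound: "ennreal (norm (v w / (z - w))) \<le> indicator (cball 0 (real m + 1)) w * ennreal (cmod (v w)) * k z w + ennreal (A w)" for w
    proof (cases "cmod (z - w) < 1")
      case True
      have "cmod w \<le> cmod z + cmod (z - w)" using norm_triangle_sub[of w z] by (simp add: norm_minus_commute)
      hence "w \<in> cball 0 (real m + 1)" using True m by auto
      thus ?thesis using True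
        by (simp add: k_def norm_divide ennreal_mult'[symmetric])
    next
      case False
      let ?J = "japanese_bracket w"
      have J: "?J \<ge> 1" by (simp add: japanese_bracket_def)
      have "?J \<le> 1 + cmod w"
        unfolding japanese_bracket_def by (rule real_le_lsqrt) (auto simp: power2_eq_square algebra_simps)
      also have "cmod w \<le> cmod z + cmod (z - w)" using norm_triangle_sub[of w z] by (simp add: norm_minus_commute)
      also have "1 + (cmod z + cmod (z - w)) \<le> (2 + cmod z) * cmod (z - w)"
        using False mult_right_mono[of 1 "cmod (z - w)" "1 + cmod z"] by (simp add: algebra_simps)
      finally have "?J \<le> (2 + cmod z) * cmod (z - w)" by simp
      hence 1: "1 / cmod (z - w) \<le> (2 + cmod z) * inverse ?J"
        using less_le_trans[OF zero_less_one leI[OF False]] J by (simp add: field_simps)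
      have "norm (v w / (z - w)) = cmod (V w) * inverse ?J * (1 / cmod (z - w))"
        using J by (simp add: V(2) norm_divide norm_mult norm_inverse powr_minus)
      also have "\<dots> \<le> cmod (V w) * inverse ?J * ((2 + cmod z) * inverse ?J)"
        using J by (intro mult_left_mono 1) auto
      also have "\<dots> = (2 + cmod z) * (cmod (V w) * (inverse ?J)\<^sup>2)"
        by (simp add: power2_eq_square)
      also have "\<dots> \<le> A w"
      proof -
        have "cmod (V w) * (inverse ?J)\<^sup>2 \<le> (cmod (V w))\<^sup>2 + ((inverse ?J)\<^sup>2)\<^sup>2"
          by (rule mult_le_sum_squares) auto
        also have "((inverse ?J)\<^sup>2)\<^sup>2 = inverse ((1 + (cmod w)\<^sup>2)\<^sup>2)"
          by (simp add: japanese_bracket_def power_inverse)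
        finally show ?thesis unfolding A_def by (intro mult_left_mono) auto
      qed
      finally show ?thesis using False by (simp add: k_def ennreal_leI)
    qed
    have [measurable]: "(\<lambda>w. k z w) \<in> borel_measurable lebesgue"
      unfolding k_def by (intro measurable_completion) measurable
    have [measurable]: "(\<lambda>w. z - w) \<in> borel_measurable lebesgue"
      by (intro measurable_completion) measurable
    have "(\<integral>\<^sup>+w. ennreal (norm (v w / (z - w))) \<partial>lebesgue)
        \<le> (\<integral>\<^sup>+w. indicator (cball 0 (real m + 1)) w * ennreal (cmod (v w)) * k z w + ennreal (A w) \<partial>lebesgue)"
      by (intro nn_integral_mono bound)
    also have "\<dots> = (\<integral>\<^sup>+w. indicator (cball 0 (real m + 1)) w * ennreal (cmod (v w)) * k z w \<partial>lebesgue)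
         + (\<integral>\<^sup>+w. ennreal (A w) \<partial>lebesgue)"
      using A by (intro nn_integral_add) auto
    also have "(\<integral>\<^sup>+w. indicator (cball 0 (real m + 1)) w * ennreal (cmod (v w)) * k z w \<partial>lebesgue)
       = (\<integral>\<^sup>+w. indicator (cball 0 (real m + 1)) w * f w * k z w \<partial>lborel)"
      unfolding nn_integral_completion using f by (intro nn_integral_cong_AE) (auto elim!: eventually_mono)
    also have "\<dots> + (\<integral>\<^sup>+w. ennreal (A w) \<partial>lebesgue) < \<infinity>"
      using z A A0 by (auto simp: integrable_iff_bounded less_top)
    finally show ?thesis by (intro integrableI_bounded) measurable
  qed
  hence "AE z in lborel. integrable lebesgue (\<lambda>w. v w / (z - w))"
    using near by (auto elim: eventually_mono)
  thus ?thesis by (rule AE_completion)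
qed

section \<open>Lebesgue points\<close>

text \<open>Differentiation of integrals handles \<open>cmod (u z - c)\<close> for a fixed
  \<open>c\<close>, whereas here the constant \<open>u a\<close> moves with the point. The fixed
  version is used for all \<open>c\<close> in a countable dense set, and \<open>u a\<close> is then
  approximated by such a \<open>c\<close>.\<close>

lemma lebesgue_points:
  assumes "locally_integrable u"
  shows "AE a in lebesgue. \<forall>e>0. \<exists>d>0. \<forall>h. 0 < h \<and> h < d \<longrightarrow>
    (\<integral>z\<in>cbox a (a + h *\<^sub>R One). cmod (u z - u a) \<partial>lebesgue) \<le> e * h\<^sup>2"
proof -
  obtain Q :: "complex set" where Q: "countable Q" "\<And>X. open X \<Longrightarrow> X \<noteq> {} \<Longrightarrow> \<exists>d\<in>Q. d \<in> X"
    using countable_dense_setE by blast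
  have u: "u absolutely_integrable_on cbox a b" for a b
    using assms by (auto simp: locally_integrable_def)
  have uc: "(\<lambda>z. cmod (u z - c)) absolutely_integrable_on cbox a b" for a b c
    by (intro set_integrable_norm set_integral_diff(1) u absolutely_integrable_on_const) auto
  have "AE a in lebesgue. \<forall>e>0. \<exists>d>0. \<forall>h. 0 < h \<and> h < d \<longrightarrow>
      norm (integral (cbox a (a + h *\<^sub>R One)) (\<lambda>z. cmod (u z - c)) /\<^sub>R h ^ DIM(complex) - cmod (u a - c)) < e" for c
  proof -
    obtain N where N: "negligible N" "\<And>x e. \<lbrakk>x \<notin> N; 0 < e\<rbrakk> \<Longrightarrow>
        \<exists>d>0. \<forall>h. 0 < h \<and> h < d \<longrightarrow>
          norm(integral (cbox x (x + h *\<^sub>R One)) (\<lambda>z. cmod (u z - c)) /\<^sub>R h ^ DIM(complex) - cmod (u x - c)) < e"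
      by (rule integrable_ccontinuous_explicit[of "\<lambda>z. cmod (u z - c)"])
        (auto intro: set_lebesgue_integral_eq_integral(1) uc)
    have "AE a in lebesgue. a \<notin> N"
      using N(1) by (intro AE_not_in) (simp add: negligible_iff_null_sets)
    thus ?thesis
      by (rule eventually_mono) (intro allI impI N(2))
  qed
  hence "AE a in lebesgue. \<forall>c\<in>Q. \<forall>e>0. \<exists>d>0. \<forall>h. 0 < h \<and> h < d \<longrightarrow>
      norm (integral (cbox a (a + h *\<^sub>R One)) (\<lambda>z. cmod (u z - c)) /\<^sub>R h ^ DIM(complex) - cmod (u a - c)) < e"
    using Q(1) by (subst AE_ball_countable) auto
  thus ?thesis
  proof (rule eventually_mono, intro allI impI)
    fix a e assume a: "\<forall>c\<in>Q. \<forall>e>0. \<exists>d>0. \<forall>h. 0 < h \<and> h < d \<longrightarrow>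
      norm (integral (cbox a (a + h *\<^sub>R One)) (\<lambda>z. cmod (u z - c)) /\<^sub>R h ^ DIM(complex) - cmod (u a - c)) < e" and "e > (0::real)"
    \<comment> \<open>The constant \<open>c\<close> is paid for twice, once in the triangle
      inequality and once in the limit of the averages; with the averaging error this makes three
      thirds of \<open>e\<close>.\<close>
    obtain c where c: "c \<in> Q" "cmod (u a - c) < e / 3"
      using Q(2)[of "ball (u a) (e / 3)"] \<open>e > 0\<close> by (auto simp: dist_norm)
    obtain d where d: "d > 0" "\<And>h. 0 < h \<Longrightarrow> h < d \<Longrightarrow>
        norm (integral (cbox a (a + h *\<^sub>R One)) (\<lambda>z. cmod (u z - c)) /\<^sub>R h ^ DIM(complex) - cmod (u a - c)) < e / 3"
      using a c(1) \<open>e > 0\<close> by (metis divide_pos_pos zero_less_numeral)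
    show "\<exists>d>0. \<forall>h. 0 < h \<and> h < d \<longrightarrow>
      (\<integral>z\<in>cbox a (a + h *\<^sub>R One). cmod (u z - u a) \<partial>lebesgue) \<le> e * h\<^sup>2"
    proof (intro exI conjI allI impI)
      fix h assume h: "0 < h \<and> h < d"
      let ?B = "cbox a (a + h *\<^sub>R One)"
      have cont: "measure lborel ?B = h\<^sup>2"
        using h by (subst content_cbox_if) (auto simp: box_ne_empty inner_add_left Basis_complex_def power2_eq_square)
      have cst: "(\<lambda>z. cmod (u a - c)) absolutely_integrable_on ?B"
        by (intro absolutely_integrable_on_const) auto
      have "(\<integral>z\<in>?B. cmod (u z - u a) \<partial>lebesgue) = integral ?B (\<lambda>z. cmod (u z - u a))"
        by (rule set_lebesgue_integral_eq_integral(2)[OF uc])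
      also have "\<dots> \<le> integral ?B (\<lambda>z. cmod (u z - c) + cmod (u a - c))"
        using uc cst norm_triangle_ineq4[of "u _ - c" "u a - c"]
        by (intro integral_le) (auto intro!: set_lebesgue_integral_eq_integral(1) set_integral_add)
      also have "\<dots> = integral ?B (\<lambda>z. cmod (u z - c)) + cmod (u a - c) * h\<^sup>2"
        using uc cst by (subst Henstock_Kurzweil_Integration.integral_add)
          (auto intro!: set_lebesgue_integral_eq_integral(1) simp: cont)
      also have "integral ?B (\<lambda>z. cmod (u z - c)) \<le> (cmod (u a - c) + e / 3) * h\<^sup>2"
      proof -
        have "\<bar>integral ?B (\<lambda>z. cmod (u z - c)) / h\<^sup>2 - cmod (u a - c)\<bar> < e / 3"
          using d(2)[of h] h by (simp add: divide_inverse_commute[of _ "h\<^sup>2"])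
        hence "integral ?B (\<lambda>z. cmod (u z - c)) / h\<^sup>2 \<le> cmod (u a - c) + e / 3"
          by linarith
        thus ?thesis using h by (simp add: pos_divide_le_eq)
      qed
      also have "(cmod (u a - c) + e / 3) * h\<^sup>2 + cmod (u a - c) * h\<^sup>2 \<le> e * h\<^sup>2"
      proof -
        have "(2 * cmod (u a - c) + e / 3) * h\<^sup>2 \<le> e * h\<^sup>2"
          using c(2) by (intro mult_right_mono) auto
        thus ?thesis by (simp add: algebra_simps)
      qed
      finally show "(\<integral>z\<in>?B. cmod (u z - u a) \<partial>lebesgue) \<le> e * h\<^sup>2" by simp
    qed (rule d(1))
  qed
qed


section \<open>Limits of the inner, outer and kernel integrals\<close>

lemma integrable_mult_bounded_compact_support:
  assumes "locally_integrable u" "g \<in> borel_measurable borel" "compact K"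
    and "\<And>z. cmod (g z) \<le> C" "\<And>z. z \<notin> K \<Longrightarrow> g z = 0"
  shows "integrable lebesgue (\<lambda>z. u z * g z)"
proof -
  have [measurable]: "g \<in> borel_measurable lebesgue"
    using assms(2) by (intro measurable_completion) simp
  have u: "integrable lebesgue (\<lambda>z. indicator K z *\<^sub>R u z)"
    using assms(1,3) by (simp add: locally_integrable_def set_integrable_def)
  have "integrable lebesgue (\<lambda>z. (indicator K z *\<^sub>R u z) * g z)"
  proof (rule Bochner_Integration.integrable_bound)
    show "integrable lebesgue (\<lambda>z. norm (indicator K z *\<^sub>R u z) * C)"
      by (intro integrable_mult_left integrable_norm u)
    show "(\<lambda>z. (indicator K z *\<^sub>R u z) * g z) \<in> borel_measurable lebesgue"
      using borel_measurable_integrable[OF u] by measurable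
    show "AE z in lebesgue. norm ((indicator K z *\<^sub>R u z) * g z) \<le> norm (norm (indicator K z *\<^sub>R u z) * C)"
      using assms(4) order.trans[OF norm_ge_zero assms(4)]
      by (auto simp: norm_mult mult.assoc intro!: AE_I2 mult_left_mono)
  qed
  also have "(\<lambda>z. (indicator K z *\<^sub>R u z) * g z) = (\<lambda>z. u z * g z)"
    using assms(5) by (auto simp: indicator_def)
  finally show ?thesis .
qed

text \<open>The disc of radius \<open>2 / Suc n\<close> about \<open>centre a n\<close> lies in the square with lower left corner
  \<open>a\<close> and side \<open>4 / Suc n\<close>; the differentiation theorem of the library is about such squares.\<close>

definition centre :: "complex \<Rightarrow> nat \<Rightarrow> complex" where
  "centre a n = a + of_real (2 / real (Suc n)) * (1 + \<i>)"

text \<open>The 3 is a rounding of \<open>2 * sqrt 2\<close>; it reappears as the shift in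
  \<open>outer_limit\<close> and inside the factor 4 of \<open>kernel_limit\<close>.\<close>

lemma dist_centre: "cmod (centre a n - a) \<le> 3 / real (Suc n)"
proof -
  have "cmod (1 + \<i>) = sqrt 2" by (simp add: cmod_def)
  also have "\<dots> \<le> 3 / 2" by (rule real_le_lsqrt) (auto simp: power2_eq_square)
  finally have "2 / real (Suc n) * cmod (1 + \<i>) \<le> 2 / real (Suc n) * (3 / 2)"
    by (intro mult_left_mono) auto
  also have "2 / real (Suc n) * (3 / 2) = 3 / real (Suc n)" by (simp add: field_simps)
  also have "2 / real (Suc n) * cmod (1 + \<i>) = cmod (centre a n - a)"
    by (simp only: centre_def add_diff_cancel_left' norm_mult norm_of_real) simp
  finally show ?thesis .
qed

lemma centre_tendsto: "centre a \<longlonglongrightarrow> a"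
proof -
  have "(\<lambda>n. 3 / real (Suc n)) \<longlonglongrightarrow> 0" by (rule LIMSEQ_Suc[OF lim_const_over_n])
  hence "(\<lambda>n. centre a n - a) \<longlonglongrightarrow> 0"
    by (rule Lim_null_comparison[rotated]) (intro always_eventually allI dist_centre)
  thus ?thesis by (rule LIM_zero_cancel)
qed

lemma bump_bound:
  fixes s :: "real \<Rightarrow> real"
  assumes "continuous_on UNIV s" "\<And>t. t \<notin> {1..2} \<Longrightarrow> s t = 0"
  obtains C where "C > 0" "\<And>t. \<bar>s t\<bar> \<le> C"
proof -
  have "bounded (s ` {1..2})"
    by (intro compact_imp_bounded compact_continuous_image continuous_on_subset[OF assms(1)]) auto
  then obtain C where C: "C > 0" "\<And>t. t \<in> {1..2} \<Longrightarrow> \<bar>s t\<bar> \<le> C"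
    by (auto simp: bounded_pos)
  hence "\<bar>s t\<bar> \<le> C" for t
    using assms(2)[of t] by (cases "t \<in> {1..2}") auto
  with C(1) show ?thesis by (rule that)
qed

text \<open>One statement serves both scales: large \<open>k\<close> concentrates the bump near
  \<open>b\<close>, small \<open>k\<close> spreads it towards infinity.\<close>

lemma integrable_mult_radial_bump:
  assumes "locally_integrable u" "continuous_on UNIV s" "\<And>t. t \<notin> {1..2} \<Longrightarrow> s t = (0::real)" "k > 0"
  shows "integrable lebesgue (\<lambda>z. u z * of_real (k * s (k * (cmod (z - b))\<^sup>2)))"
proof -
  obtain C where C: "C > 0" "\<And>t. \<bar>s t\<bar> \<le> C" using bump_bound[OF assms(2,3)] by blast
  have [measurable]: "s \<in> borel_measurable borel"
    by (rule borel_measurable_continuous_onI) fact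
  show ?thesis
  proof (rule integrable_mult_bounded_compact_support[OF assms(1), where K="cball b (sqrt (2 / k))" and C="k * C"])
    show "(\<lambda>z. complex_of_real (k * s (k * (cmod (z - b))\<^sup>2))) \<in> borel_measurable borel" by measurable
    show "cmod (of_real (k * s (k * (cmod (z - b))\<^sup>2))) \<le> k * C" for z
      using C(2) \<open>k > 0\<close> by (simp add: norm_mult)
    show "complex_of_real (k * s (k * (cmod (z - b))\<^sup>2)) = 0" if "z \<notin> cball b (sqrt (2 / k))" for z
    proof -
      have "\<not> cmod (z - b) \<le> sqrt (2 / k)" using that by (simp add: dist_norm norm_minus_commute)
      hence "\<not> (cmod (z - b))\<^sup>2 \<le> 2 / k" using real_le_rsqrt by blast
      hence "k * (cmod (z - b))\<^sup>2 > 2" using \<open>k > 0\<close> by (simp add: field_simps)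
      thus ?thesis using assms(3) by simp
    qed
  qed auto
qed

text \<open>The weight is an approximate identity of mass \<open>pi\<close>: it is of size
  \<open>N^2\<close> and lives in a square of area \<open>16 / N^2\<close> with corner
  \<open>a\<close>, so the error is controlled by the mean of \<open>cmod (u z - u a)\<close> over
  that square.\<close>

lemma inner_limit:
  assumes u: "locally_integrable u"
    and S: "\<And>t. (S has_real_derivative s t) (at t)" "S 1 = 0" "S 2 = 1"
    and s: "continuous_on UNIV s" "\<And>t. t \<notin> {1..2} \<Longrightarrow> s t = 0"
    and leb: "\<And>e. e > 0 \<Longrightarrow> \<exists>d>0. \<forall>h. 0 < h \<and> h < d \<longrightarrow>
      (\<integral>z\<in>cbox a (a + h *\<^sub>R One). cmod (u z - u a) \<partial>lebesgue) \<le> e * h\<^sup>2"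
  shows "(\<lambda>n. \<integral>z. u z * of_real ((real (Suc n))\<^sup>2 * s ((real (Suc n))\<^sup>2 * (cmod (z - centre a n))\<^sup>2)) \<partial>lebesgue)
     \<longlonglongrightarrow> of_real pi * u a" (is "?I \<longlonglongrightarrow> _")
proof (rule LIMSEQ_I)
  fix e :: real assume "e > 0"
  obtain C where C: "C > 0" "\<And>t. \<bar>s t\<bar> \<le> C" using bump_bound[OF s] by blast
  \<comment> \<open>The area \<open>16 / N^2\<close> of the square against the bound
    \<open>N^2 * C\<close> of the weight leaves \<open>16 * C\<close>; the remaining factor 2 makes
    the final bound \<open>e / 2\<close>.\<close>
  have "e / (32 * C) > 0" using \<open>e > 0\<close> C by simp
  then obtain d where d: "d > 0" "\<And>h. 0 < h \<Longrightarrow> h < d \<Longrightarrow>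
      (\<integral>z\<in>cbox a (a + h *\<^sub>R One). cmod (u z - u a) \<partial>lebesgue) \<le> e / (32 * C) * h\<^sup>2"
    using leb by metis
  have "(\<lambda>n. 4 / real (Suc n)) \<longlonglongrightarrow> 0" by (rule LIMSEQ_Suc[OF lim_const_over_n])
  from order_tendstoD(2)[OF this d(1)]
  obtain n0 where n0: "\<And>n. n \<ge> n0 \<Longrightarrow> 4 / real (Suc n) < d"
    unfolding eventually_sequentially by blast
  show "\<exists>n0. \<forall>n\<ge>n0. norm (?I n - of_real pi * u a) < e"
  proof (intro exI allI impI)
    fix n assume "n \<ge> n0"
    define N where "N = real (Suc n)"
    have N: "N > 0" by (simp add: N_def)
    let ?b = "centre a n" and ?B = "cbox a (a + (4 / N) *\<^sub>R One)"
    define w where "w z = N\<^sup>2 * s (N\<^sup>2 * (cmod (z - ?b))\<^sup>2)" for z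
    have int_u: "integrable lebesgue (\<lambda>z. u z * of_real (w z))"
      unfolding w_def by (intro integrable_mult_radial_bump u s) (use N in auto)
    \<comment> \<open>With the constant 1 in place of \<open>u\<close>, the general lemma gives
      integrability of the weight itself.\<close>
    have one: "locally_integrable (\<lambda>z. 1)"
      unfolding locally_integrable_def
      by (auto intro!: absolutely_integrable_on_const lmeasurable_compact)
    have int_1: "integrable lebesgue (\<lambda>z. complex_of_real (w z))"
      using integrable_mult_radial_bump[OF one s, of "N\<^sup>2" ?b] N by (simp add: w_def)
    have "(\<integral>z. w z \<partial>lebesgue) = pi * (S (N\<^sup>2 * (2 / N\<^sup>2)) - S (N\<^sup>2 * (1 / N\<^sup>2)))"
      unfolding w_def
    proof (rule integral_radial_derivative[where F = "\<lambda>t. S (N\<^sup>2 * t)" and F' = "\<lambda>t. N\<^sup>2 * s (N\<^sup>2 * t)"])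
      show "((\<lambda>t. S (N\<^sup>2 * t)) has_real_derivative N\<^sup>2 * s (N\<^sup>2 * t)) (at t)" for t
        by (rule DERIV_cong[OF DERIV_chain2[OF S(1)]]) (auto intro!: derivative_eq_intros)
      show "continuous_on UNIV (\<lambda>t. N\<^sup>2 * s (N\<^sup>2 * t))"
        by (intro continuous_intros continuous_on_compose2[OF s(1)]) auto
      show "N\<^sup>2 * s (N\<^sup>2 * t) = 0" if "t \<notin> {1 / N\<^sup>2..2 / N\<^sup>2}" for t
        using that N s(2)[of "N\<^sup>2 * t"] by (auto simp: field_simps)
    qed (use N in \<open>auto simp: divide_right_mono\<close>)
    hence w_int: "(\<integral>z. of_real (w z) \<partial>lebesgue) = complex_of_real pi"
      using N S by simp
    have "?I n - of_real pi * u a = (\<integral>z. u z * of_real (w z) - u a * of_real (w z) \<partial>lebesgue)"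
      using int_u int_1 w_int
      by (subst Bochner_Integration.integral_diff) (auto simp: w_def N_def mult.commute)
    also have "\<dots> = (\<integral>z. (u z - u a) * of_real (w z) \<partial>lebesgue)"
      by (simp add: algebra_simps)
    finally have eq: "?I n - of_real pi * u a = (\<integral>z. (u z - u a) * of_real (w z) \<partial>lebesgue)" .
    have int_B: "integrable lebesgue (\<lambda>z. indicator ?B z *\<^sub>R cmod (u z - u a))"
    proof -
      have "(\<lambda>z. cmod (u z - u a)) absolutely_integrable_on ?B"
        using u by (intro set_integrable_norm set_integral_diff(1) absolutely_integrable_on_const)
          (auto simp: locally_integrable_def)
      thus ?thesis by (simp add: set_integrable_def)
    qed
    have ptw: "norm ((u z - u a) * of_real (w z)) \<le> N\<^sup>2 * C * (indicator ?B z *\<^sub>R cmod (u z - u a))" for z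
    proof (cases "z \<in> ?B")
      case True
      have "\<bar>w z\<bar> \<le> N\<^sup>2 * C" using C(2) by (simp add: w_def abs_mult mult_left_mono)
      hence "\<bar>w z\<bar> * cmod (u z - u a) \<le> N\<^sup>2 * C * cmod (u z - u a)" by (intro mult_right_mono) auto
      thus ?thesis using True by (simp add: norm_mult mult.commute)
    next
      case False
      \<comment> \<open>The support of the weight has radius \<open>sqrt 2 / N\<close>; enlarging 2
        to \<open>2^2\<close> gives the radius \<open>2 / N\<close>, and that disc lies in the
        square.\<close>
      have "N\<^sup>2 * (cmod (z - ?b))\<^sup>2 > 2"
      proof (rule ccontr)
        assume "\<not> N\<^sup>2 * (cmod (z - ?b))\<^sup>2 > 2"
        hence "(N * cmod (z - ?b))\<^sup>2 \<le> 2\<^sup>2" by (simp add: power_mult_distrib)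
        hence "N * cmod (z - ?b) \<le> 2" by (rule power2_le_imp_le) simp
        hence "cmod (z - ?b) \<le> 2 / N" using N by (simp add: field_simps)
        hence "\<bar>Re (z - ?b)\<bar> \<le> 2 / N" "\<bar>Im (z - ?b)\<bar> \<le> 2 / N"
          using abs_Re_le_cmod abs_Im_le_cmod order.trans by blast+
        moreover have "Re ?b = Re a + 2 / N" "Im ?b = Im a + 2 / N"
          by (simp_all add: centre_def N_def)
        moreover have "4 / N = 2 / N + 2 / N" by simp
        ultimately have "Re a \<le> Re z \<and> Re z \<le> Re a + 4 / N \<and> Im a \<le> Im z \<and> Im z \<le> Im a + 4 / N"
          unfolding minus_complex.sel abs_le_iff by linarith
        hence "z \<in> ?B"
          by (auto simp: in_cbox_complex_iff Basis_complex_def)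
        thus False using False by simp
      qed
      thus ?thesis using s(2) False by (simp add: w_def)
    qed
    have "norm (?I n - of_real pi * u a) \<le> (\<integral>z. norm ((u z - u a) * of_real (w z)) \<partial>lebesgue)"
      unfolding eq by (rule integral_norm_bound)
    also have "\<dots> \<le> (\<integral>z. N\<^sup>2 * C * (indicator ?B z *\<^sub>R cmod (u z - u a)) \<partial>lebesgue)"
      using C(1) by (intro integral_mono' integrable_mult_right int_B ptw) auto
    also have "\<dots> = N\<^sup>2 * C * (\<integral>z\<in>?B. cmod (u z - u a) \<partial>lebesgue)"
      unfolding set_lebesgue_integral_def by (rule integral_mult_right_zero)
    also have "\<dots> \<le> N\<^sup>2 * C * (e / (32 * C) * (4 / N)\<^sup>2)"
      using n0[OF \<open>n \<ge> n0\<close>] N C(1) by (intro mult_left_mono d(2)) (auto simp: N_def)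
    also have "\<dots> = e / 2" using N C(1) by (simp add: field_simps power2_eq_square)
    also have "\<dots> < e" using \<open>e > 0\<close> by simp
    finally show "norm (?I n - of_real pi * u a) < e" .
  qed
qed

text \<open>On the annulus the bracket is at most \<open>4 * N\<close> and the weight at most
  \<open>C / N^2\<close>, so the integrand is of size \<open>cmod (U z) / N\<close> on a set of area
  of order \<open>N^2\<close>. The integral is thus governed by the \<open>L^2\<close> tail of
  \<open>U\<close>, which tends to 0.\<close>

lemma outer_limit:
  assumes U: "U \<in> L2_complex" "u = (\<lambda>z. of_real (japanese_bracket z powr 1) * U z)"
    and s: "continuous_on UNIV s" "\<And>t. t \<notin> {1..2} \<Longrightarrow> s t = 0"
  shows "(\<lambda>n. \<integral>z. u z * of_real (inverse ((real (Suc n))\<^sup>2) * s (inverse ((real (Suc n))\<^sup>2) * (cmod (z - centre a n))\<^sup>2)) \<partial>lebesgue)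
     \<longlonglongrightarrow> 0" (is "?I \<longlonglongrightarrow> _")
proof (rule LIMSEQ_I)
  fix e :: real assume "e > 0"
  obtain C where C: "C > 0" "\<And>t. \<bar>s t\<bar> \<le> C" using bump_bound[OF s] by blast
  have [measurable]: "U \<in> borel_measurable lebesgue" and U2: "integrable lebesgue (\<lambda>z. (cmod (U z))\<^sup>2)"
    using U(1) by (auto simp: L2_complex_def)
  \<comment> \<open>Contains the annulus: there \<open>cmod (z - centre a n) \<ge> Suc n\<close>,
    and the centre has modulus at most \<open>cmod a + 3\<close>.\<close>
  define E where "E n = {z. real (Suc n) - cmod a - 3 \<le> cmod z}" for n
  have "closed (E n)" for n
    unfolding E_def by (intro closed_Collect_le continuous_intros)
  hence [measurable]: "E n \<in> sets lebesgue" for n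
    using borel_closed[of "E n"] by (simp add: sets_completionI_sets)
  define T where "T n = (\<integral>z. (cmod (U z))\<^sup>2 * indicator (E n) z \<partial>lebesgue)" for n
  have T_int: "integrable lebesgue (\<lambda>z. (cmod (U z))\<^sup>2 * indicator (E n) z)" for n
    by (rule Bochner_Integration.integrable_bound[OF U2]) (auto simp: indicator_def)
  have "T \<longlonglongrightarrow> (\<integral>z. 0 \<partial>(lebesgue :: complex measure))"
    unfolding T_def[abs_def]
  proof (rule integral_dominated_convergence[where w="\<lambda>z. (cmod (U z))\<^sup>2"])
    show "AE z in lebesgue. (\<lambda>n. (cmod (U z))\<^sup>2 * indicator (E n) z) \<longlonglongrightarrow> 0"
    proof (rule AE_I2)
      fix z :: complex
      obtain m where m: "cmod z + cmod a + 3 < real m" using reals_Archimedean2 by blast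
      have "\<forall>\<^sub>F n in sequentially. (cmod (U z))\<^sup>2 * indicator (E n) z = 0"
        using eventually_ge_at_top[of m] by eventually_elim (use m in \<open>auto simp: E_def indicator_def\<close>)
      thus "(\<lambda>n. (cmod (U z))\<^sup>2 * indicator (E n) z) \<longlonglongrightarrow> 0"
        by (rule tendsto_eventually)
    qed
  qed (use U2 in \<open>auto simp: indicator_def\<close>)
  hence T: "T \<longlonglongrightarrow> 0" by simp
  \<comment> \<open>A balancing parameter for splitting the product. Its value makes the area term
    \<open>16 * C * pi * q\<close> equal to \<open>e / 4\<close>; the tail term is then pushed below
    \<open>e / 2\<close> by taking \<open>n\<close> large.\<close>
  define q where "q = e / (64 * C * pi)"
  have q: "q > 0" using \<open>e > 0\<close> C by (simp add: q_def)
  have "e * q / (8 * C) > 0" using \<open>e > 0\<close> C q by simp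
  from order_tendstoD(2)[OF T this] obtain n1 where n1: "\<And>n. n \<ge> n1 \<Longrightarrow> T n < e * q / (8 * C)"
    unfolding eventually_sequentially by blast
  obtain n2 :: nat where n2: "cmod a + 3 \<le> real n2" using real_arch_simple by blast
  show "\<exists>n0. \<forall>n\<ge>n0. norm (?I n - 0) < e"
  proof (intro exI allI impI)
    fix n assume n: "n \<ge> max n1 n2"
    define N where "N = real (Suc n)"
    have N: "N \<ge> 1" "cmod a + 3 \<le> N" using n n2 by (auto simp: N_def)
    let ?b = "centre a n"
    have ba: "cmod (?b - a) \<le> 3"
    proof -
      have "3 / N \<le> 3" using N by (simp add: divide_le_eq)
      thus ?thesis using dist_centre[of a n] unfolding N_def by linarith
    qed
    define w where "w z = inverse (N\<^sup>2) * s (inverse (N\<^sup>2) * (cmod (z - ?b))\<^sup>2)" for z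
    define G where "G z = 4 * C * ((1 / q) * ((cmod (U z))\<^sup>2 * indicator (E n) z) + (q / N\<^sup>2) * indicator (cball ?b (2 * N)) z)" for z
    have G0: "G z \<ge> 0" for z using q C by (simp add: G_def)
    have ptw: "norm (u z * of_real (w z)) \<le> G z" for z
    proof (cases "inverse (N\<^sup>2) * (cmod (z - ?b))\<^sup>2 \<in> {1..2}")
      case False
      thus ?thesis using s(2) G0[of z] by (simp add: w_def)
    next
      case True
      hence "N\<^sup>2 \<le> (cmod (z - ?b))\<^sup>2" "(cmod (z - ?b))\<^sup>2 \<le> 2 * N\<^sup>2"
        using N by (auto simp: field_simps)
      moreover from this have "(cmod (z - ?b))\<^sup>2 \<le> (2 * N)\<^sup>2" by (simp add: power_mult_distrib)
      ultimately have zb: "N \<le> cmod (z - ?b)" "cmod (z - ?b) \<le> 2 * N"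
        using N by (auto intro: power2_le_imp_le)
      have "cmod (z - ?b) \<le> cmod z + (cmod a + cmod (?b - a))"
        using norm_triangle_ineq4[of z ?b] norm_triangle_ineq[of a "?b - a"] by simp
      hence zE: "z \<in> E n" using zb ba by (simp add: E_def N_def)
      have zc: "z \<in> cball ?b (2 * N)" using zb by (simp add: dist_norm norm_minus_commute)
      have "cmod z \<le> cmod (z - ?b) + (cmod a + cmod (?b - a))"
        using norm_triangle_ineq[of "z - ?b" ?b] norm_triangle_ineq[of a "?b - a"] by simp
      hence z: "cmod z \<le> 3 * N" using zb ba N by linarith
      have "japanese_bracket z \<le> 1 + cmod z"
        unfolding japanese_bracket_def by (rule real_le_lsqrt) (auto simp: power2_eq_square algebra_simps)
      hence J: "japanese_bracket z \<le> 4 * N" using z N by linarith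
      have J0: "japanese_bracket z \<ge> 0" by (simp add: japanese_bracket_def)
      have "norm (u z * of_real (w z)) = japanese_bracket z * cmod (U z) * (inverse (N\<^sup>2) * \<bar>s (inverse (N\<^sup>2) * (cmod (z - ?b))\<^sup>2)\<bar>)"
        using J0 by (simp add: U(2) w_def norm_mult norm_inverse norm_power abs_mult)
      also have "\<dots> \<le> (4 * N) * cmod (U z) * (inverse (N\<^sup>2) * C)"
        using J J0 C N by (intro mult_mono) auto
      \<comment> \<open>Inserting \<open>sqrt q\<close> and its inverse puts a large factor on the
        vanishing tail of \<open>U\<close> and a small one on the area.\<close>
      also have "\<dots> = 4 * C * ((cmod (U z) / sqrt q) * (sqrt q / N))"
        using N q by (simp add: field_simps power2_eq_square)
      also have "\<dots> \<le> 4 * C * ((cmod (U z) / sqrt q)\<^sup>2 + (sqrt q / N)\<^sup>2)"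
        using C N q by (intro mult_left_mono mult_le_sum_squares) auto
      also have "\<dots> = G z" using q zE zc by (simp add: G_def power_divide)
      finally show ?thesis .
    qed
    have c_int: "integrable lebesgue (indicator (cball ?b (2 * N)) :: complex \<Rightarrow> real)"
      using N by (intro integrable_real_indicator) (auto simp: emeasure_cball)
    have c_val: "(\<integral>z. indicator (cball ?b (2 * N)) z \<partial>lebesgue) = pi * (2 * N)\<^sup>2"
      using N by (simp add: measure_completion content_cball unit_ball_vol_2)
    have G_int: "integrable lebesgue G"
      unfolding G_def using T_int c_int by (intro integrable_mult_right Bochner_Integration.integrable_add) auto
    have "norm (?I n - 0) \<le> (\<integral>z. norm (u z * of_real (w z)) \<partial>lebesgue)"
      unfolding w_def N_def diff_zero by (rule integral_norm_bound)
    also have "\<dots> \<le> (\<integral>z. G z \<partial>lebesgue)"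
      by (intro integral_mono' G_int ptw G0)
    also have "\<dots> = 4 * C * ((1 / q) * T n + (q / N\<^sup>2) * (pi * (2 * N)\<^sup>2))"
      unfolding G_def T_def c_val[symmetric] using T_int c_int by simp
    also have "\<dots> = 4 * C / q * T n + 16 * C * pi * q"
      using N by (simp add: field_simps power2_eq_square)
    also have "\<dots> < 4 * C / q * (e * q / (8 * C)) + 16 * C * pi * q"
      using n1[of n] n C q by (intro add_strict_right_mono mult_strict_left_mono) auto
    also have "\<dots> = e / 2 + e / 4" using C q by (simp add: q_def)
    also have "\<dots> < e" using \<open>e > 0\<close> by simp
    finally show "norm (?I n - 0) < e" .
  qed
qed

text \<open>For fixed \<open>z\<close> different from \<open>a\<close> the cut-off is eventually 1.
  The majorant is uniform in \<open>n\<close> although the pole moves, because the cut-off removes a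
  disc of radius \<open>1 / N\<close> about the moving pole.\<close>

lemma kernel_limit:
  assumes v: "v \<in> borel_measurable lebesgue" "integrable lebesgue (\<lambda>w. v w / (a - w))"
    and S: "continuous_on UNIV S" "\<And>t. t \<le> 1 \<Longrightarrow> S t = 0" "\<And>t. t \<ge> 2 \<Longrightarrow> S t = 1" "\<And>t. 0 \<le> S t" "\<And>t. S t \<le> (1::real)"
  shows "(\<lambda>n. \<integral>z. v z * (of_real (S ((real (Suc n))\<^sup>2 * (cmod (z - centre a n))\<^sup>2)
        - S (inverse ((real (Suc n))\<^sup>2) * (cmod (z - centre a n))\<^sup>2)) / (z - centre a n)) \<partial>lebesgue)
     \<longlonglongrightarrow> (\<integral>z. v z / (z - a) \<partial>lebesgue)"
proof (rule integral_dominated_convergence[where w="\<lambda>z. 4 * norm (v z / (a - z))"])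
  have [measurable]: "S \<in> borel_measurable borel"
    by (rule borel_measurable_continuous_onI) fact
  note v(1)[measurable]
  have [measurable]: "(\<lambda>z. z :: complex) \<in> borel_measurable lebesgue"
    by (intro measurable_completion) simp
  show "(\<lambda>z. v z / (z - a)) \<in> borel_measurable lebesgue" by measurable
  show "(\<lambda>z. v z * (of_real (S ((real (Suc n))\<^sup>2 * (cmod (z - centre a n))\<^sup>2)
        - S (inverse ((real (Suc n))\<^sup>2) * (cmod (z - centre a n))\<^sup>2)) / (z - centre a n))) \<in> borel_measurable lebesgue" for n
    by measurable
  show "integrable lebesgue (\<lambda>z. 4 * norm (v z / (a - z)))"
    using v(2) by (intro integrable_mult_right integrable_norm)
  \<comment> \<open>At \<open>z = a\<close> the majorant is 0 by the convention on division, so that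
    point is discarded.\<close>
  have ne: "AE z in lebesgue. z \<noteq> a"
    by (rule AE_completion[OF AE_lborel_singleton])
  have N_lim: "filterlim (\<lambda>n. real (Suc n)) at_top sequentially"
    by (rule filterlim_compose[OF filterlim_real_sequentially filterlim_Suc])
  show "AE z in lebesgue. (\<lambda>n. v z * (of_real (S ((real (Suc n))\<^sup>2 * (cmod (z - centre a n))\<^sup>2)
        - S (inverse ((real (Suc n))\<^sup>2) * (cmod (z - centre a n))\<^sup>2)) / (z - centre a n))) \<longlonglongrightarrow> v z / (z - a)"
    using ne
  proof eventually_elim
    fix z assume "z \<noteq> a"
    have r: "(\<lambda>n. (cmod (z - centre a n))\<^sup>2) \<longlonglongrightarrow> (cmod (z - a))\<^sup>2"
      by (intro tendsto_intros centre_tendsto)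
    have N2: "filterlim (\<lambda>n. (real (Suc n))\<^sup>2) at_top sequentially"
      by (rule filterlim_pow_at_top[OF _ N_lim]) simp
    have "filterlim (\<lambda>n. (cmod (z - centre a n))\<^sup>2 * (real (Suc n))\<^sup>2) at_top sequentially"
      by (rule filterlim_tendsto_pos_mult_at_top[OF r _ N2]) (use \<open>z \<noteq> a\<close> in simp)
    hence 1: "\<forall>\<^sub>F n in sequentially. 2 \<le> (cmod (z - centre a n))\<^sup>2 * (real (Suc n))\<^sup>2"
      by (simp add: filterlim_at_top)
    have "(\<lambda>n. inverse ((real (Suc n))\<^sup>2) * (cmod (z - centre a n))\<^sup>2) \<longlonglongrightarrow> 0 * (cmod (z - a))\<^sup>2"
      by (intro tendsto_mult r tendsto_inverse_0_at_top N2)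
    hence 2: "\<forall>\<^sub>F n in sequentially. inverse ((real (Suc n))\<^sup>2) * (cmod (z - centre a n))\<^sup>2 < 1"
      by (intro order_tendstoD(2)[where a=1]) auto
    have "(\<lambda>n. v z * (1 / (z - centre a n))) \<longlonglongrightarrow> v z * (1 / (z - a))"
      by (intro tendsto_intros centre_tendsto) (use \<open>z \<noteq> a\<close> in simp)
    hence "(\<lambda>n. v z * (1 / (z - centre a n))) \<longlonglongrightarrow> v z / (z - a)" by simp
    thus "(\<lambda>n. v z * (of_real (S ((real (Suc n))\<^sup>2 * (cmod (z - centre a n))\<^sup>2)
        - S (inverse ((real (Suc n))\<^sup>2) * (cmod (z - centre a n))\<^sup>2)) / (z - centre a n))) \<longlonglongrightarrow> v z / (z - a)"
    proof (rule Lim_transform_eventually)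
      show "\<forall>\<^sub>F n in sequentially. v z * (1 / (z - centre a n)) =
        v z * (of_real (S ((real (Suc n))\<^sup>2 * (cmod (z - centre a n))\<^sup>2)
        - S (inverse ((real (Suc n))\<^sup>2) * (cmod (z - centre a n))\<^sup>2)) / (z - centre a n))"
        using 1 2
      proof eventually_elim
        case (elim n)
        have "S ((real (Suc n))\<^sup>2 * (cmod (z - centre a n))\<^sup>2) = 1"
          using elim(1) by (intro S(3)) (simp add: mult.commute)
        moreover have "S (inverse ((real (Suc n))\<^sup>2) * (cmod (z - centre a n))\<^sup>2) = 0"
          using elim(2) by (intro S(2)) (rule less_imp_le)
        ultimately show ?case by (simp only: of_real_diff of_real_1 of_real_0 diff_zero)
      qed
    qed
  qed
  show "AE z in lebesgue. norm (v z * (of_real (S ((real (Suc n))\<^sup>2 * (cmod (z - centre a n))\<^sup>2)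
        - S (inverse ((real (Suc n))\<^sup>2) * (cmod (z - centre a n))\<^sup>2)) / (z - centre a n)))
      \<le> 4 * norm (v z / (a - z))" for n
    using ne
  proof eventually_elim
    fix z assume "z \<noteq> a"
    define N where "N = real (Suc n)"
    have N: "N \<ge> 1" by (simp add: N_def)
    let ?b = "centre a n"
    define H where "H = S (N\<^sup>2 * (cmod (z - ?b))\<^sup>2) - S (inverse (N\<^sup>2) * (cmod (z - ?b))\<^sup>2)"
    have H1: "\<bar>H\<bar> \<le> 1"
      using S(4,5)[of "N\<^sup>2 * (cmod (z - ?b))\<^sup>2"] S(4,5)[of "inverse (N\<^sup>2) * (cmod (z - ?b))\<^sup>2"]
      by (simp add: H_def abs_le_iff)
    have "\<bar>H\<bar> / cmod (z - ?b) \<le> 4 / cmod (z - a)"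
    \<comment> \<open>Inside this disc both arguments of \<open>S\<close> are at most 1 and
      \<open>H\<close> vanishes. Outside it the shift, at most \<open>3 / N\<close>, is below three
      times \<open>cmod (z - ?b)\<close>, which gives the factor 4.\<close>
    proof (cases "N * cmod (z - ?b) \<le> 1")
      case True
      hence 1: "N\<^sup>2 * (cmod (z - ?b))\<^sup>2 \<le> 1"
        using N power_le_one[of "N * cmod (z - ?b)" 2] by (simp add: power_mult_distrib)
      have "inverse (N\<^sup>2) \<le> N\<^sup>2" 
        using N one_le_power[of N 2] inverse_le_1_iff[of "N\<^sup>2"] by linarith
      hence "inverse (N\<^sup>2) * (cmod (z - ?b))\<^sup>2 \<le> N\<^sup>2 * (cmod (z - ?b))\<^sup>2"
        by (intro mult_right_mono) auto
      with 1 have "H = 0" by (simp add: H_def S(2))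
      thus ?thesis by simp
    next
      case False
      hence zb: "1 / N < cmod (z - ?b)" using N by (simp add: field_simps)
      have "0 < 1 / N" using N by simp
      hence pos: "cmod (z - ?b) > 0" using zb by linarith
      have "cmod (z - a) \<le> cmod (z - ?b) + cmod (?b - a)"
        using norm_triangle_ineq[of "z - ?b" "?b - a"] by simp
      also have "cmod (?b - a) \<le> 3 * (1 / N)" using dist_centre[of a n] by (simp add: N_def)
      also have "cmod (z - ?b) + 3 * (1 / N) \<le> 4 * cmod (z - ?b)" using zb by linarith
      finally have "cmod (z - a) \<le> 4 * cmod (z - ?b)" by simp
      hence "1 / cmod (z - ?b) \<le> 4 / cmod (z - a)"
        using pos \<open>z \<noteq> a\<close> by (simp add: field_simps)
      moreover have "\<bar>H\<bar> / cmod (z - ?b) \<le> 1 / cmod (z - ?b)"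
        using H1 by (intro divide_right_mono) auto
      ultimately show ?thesis by linarith
    qed
    hence "cmod (v z) * (\<bar>H\<bar> / cmod (z - ?b)) \<le> cmod (v z) * (4 / cmod (z - a))"
      by (intro mult_left_mono) auto
    moreover have "norm (v z * (of_real H / (z - ?b))) = cmod (v z) * (\<bar>H\<bar> / cmod (z - ?b))"
      by (simp add: norm_mult norm_divide)
    moreover have "cmod (v z) * (4 / cmod (z - a)) = 4 * norm (v z / (a - z))"
      by (simp add: norm_divide norm_minus_commute)
    ultimately show "norm (v z * (of_real (S ((real (Suc n))\<^sup>2 * (cmod (z - centre a n))\<^sup>2)
        - S (inverse ((real (Suc n))\<^sup>2) * (cmod (z - centre a n))\<^sup>2)) / (z - centre a n)))
      \<le> 4 * norm (v z / (a - z))"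
      unfolding N_def[symmetric] H_def[symmetric] by simp
  qed
qed

section \<open>The representation formula\<close>

lemma dbar_representation_at_point:
  assumes v: "v \<in> borel_measurable lebesgue" "integrable lebesgue (\<lambda>w. v w / (a - w))"
    and u: "u \<in> weighted_L2 1" and uv: "distributional_dbar u v"
    and leb: "\<And>e. e > 0 \<Longrightarrow> \<exists>d>0. \<forall>h. 0 < h \<and> h < d \<longrightarrow>
      (\<integral>z\<in>cbox a (a + h *\<^sub>R One). cmod (u z - u a) \<partial>lebesgue) \<le> e * h\<^sup>2"
  shows "of_real pi * u a = (\<integral>w. v w / (a - w) \<partial>lebesgue)"
proof -
  obtain U where U: "U \<in> L2_complex" "u = (\<lambda>z. of_real (japanese_bracket z powr 1) * U z)"
    using u unfolding weighted_L2_def by auto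
  have loc: "locally_integrable u" using uv by (simp add: distributional_dbar_def)
  obtain S s where S: "smooth S" "smooth s" "\<And>t. (S has_real_derivative s t) (at t)"
    "\<And>t. t \<le> 1 \<Longrightarrow> S t = 0" "\<And>t. t \<ge> 2 \<Longrightarrow> S t = 1" "\<And>t. 0 \<le> S t" "\<And>t. S t \<le> 1"
    "\<And>t. t \<notin> {1..2} \<Longrightarrow> s t = 0" using smooth_step by blast
  note s = smooth_continuous[OF S(2)] S(8)
  let ?N = "\<lambda>n. (real (Suc n))\<^sup>2"
  let ?I = "\<lambda>n. \<integral>z. u z * of_real (?N n * s (?N n * (cmod (z - centre a n))\<^sup>2)) \<partial>lebesgue"
  let ?O = "\<lambda>n. \<integral>z. u z * of_real (inverse (?N n) * s (inverse (?N n) * (cmod (z - centre a n))\<^sup>2)) \<partial>lebesgue"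
  let ?J = "\<lambda>n. \<integral>z. v z * (of_real (S (?N n * (cmod (z - centre a n))\<^sup>2) - S (inverse (?N n) * (cmod (z - centre a n))\<^sup>2)) / (z - centre a n)) \<partial>lebesgue"
  have I: "?I \<longlonglongrightarrow> of_real pi * u a"
    by (rule inner_limit[OF loc S(3) _ _ s leb]) (use S(4,5) in auto)
  have O: "?O \<longlonglongrightarrow> 0"
    by (rule outer_limit[OF U s])
  have J: "?J \<longlonglongrightarrow> (\<integral>z. v z / (z - a) \<partial>lebesgue)"
    by (rule kernel_limit[OF v smooth_continuous[OF S(1)] S(4-7)])
  \<comment> \<open>The distributional equation for the radial test function: its dbar is the
    difference of the two bumps, and the minus sign is that of the distributional
    derivative.\<close>
  have eq: "?J n = - (?I n - ?O n)" for n
  proof -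
    have N: "?N n \<ge> 1" by simp
    \<comment> \<open>The added zeros bring the arguments into the shape \<open>a * t + b\<close> of
      \<open>smooth_affine\<close>.\<close>
    define H where "H t = S (?N n * t + 0) - S (inverse (?N n) * t + 0)" for t
    define H' where "H' t = ?N n * s (?N n * t) - inverse (?N n) * s (inverse (?N n) * t)" for t
    let ?\<phi> = "\<lambda>z. complex_of_real (H ((cmod (z - centre a n))\<^sup>2)) / (z - centre a n)"
    have sm: "smooth H" unfolding H_def by (intro smooth_diff smooth_affine S)
    have DS: "((\<lambda>t. S (k * t)) has_real_derivative k * s (k * t)) (at t)" for k t
      by (rule DERIV_cong[OF DERIV_chain2[OF S(3)]]) (auto intro!: derivative_eq_intros)
    have DH: "(H has_real_derivative H' t) (at t)" for t
      unfolding H_def H'_def add_0_right by (intro DERIV_diff DS)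
    \<comment> \<open>The factor \<open>?N n\<close> is at least 1, so below its inverse both steps
      are still 0; in the next claim, beyond \<open>2 * ?N n\<close>, both are already 1 and
      cancel.\<close>
    have H0: "H t = 0" if "t \<le> inverse (?N n)" for t
    proof -
      have 1: "?N n * t \<le> 1" using that N mult_left_mono[OF that, of "?N n"] by simp
      have "inverse (?N n) * t \<le> 1"
      proof (cases "t \<ge> 0")
        case True
        have "inverse (?N n) \<le> 1" using N by (simp only: inverse_le_1_iff) simp
        hence "t \<le> 1" using that by linarith
        thus ?thesis using True \<open>inverse (?N n) \<le> 1\<close> by (intro mult_le_one) auto
      next
        case False
        hence "inverse (?N n) * t \<le> 0" by (intro mult_nonneg_nonpos) auto
        thus ?thesis by linarith
      qed
      with 1 show ?thesis unfolding H_def by (simp only: S(4) add_0_right diff_self)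
    qed
    have H1: "H t = 0" if "t \<ge> 2 * ?N n" for t
    proof -
      have t: "t \<ge> 2" using that N by linarith
      have "inverse (?N n) * t \<ge> 2"
      proof -
        have "inverse k * t \<ge> 2" if "k > 0" "t \<ge> 2 * k" for k :: real
          using that by (simp add: field_simps)
        from this[OF _ that] N show ?thesis by linarith
      qed
      moreover have "?N n * t \<ge> 2" using mult_mono[OF N t] N by simp
      ultimately show ?thesis unfolding H_def by (simp only: S(5) add_0_right diff_self)
    qed
    note tf = radial_test_function[where b = "centre a n" and c = "inverse (?N n)" and R = "2 * ?N n", OF sm DH _ H0 H1]
    have "?\<phi> \<in> test_functions" by (rule tf(1)) auto
    moreover have "dbar ?\<phi> z = of_real (H' ((cmod (z - centre a n))\<^sup>2))" for z
      by (rule tf(2)) auto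
    ultimately have "- (\<integral>z. u z * of_real (H' ((cmod (z - centre a n))\<^sup>2)) \<partial>lebesgue) = (\<integral>z. v z * ?\<phi> z \<partial>lebesgue)"
      using uv unfolding distributional_dbar_def by (metis (no_types, lifting) ext)
    moreover have "(\<integral>z. u z * of_real (H' ((cmod (z - centre a n))\<^sup>2)) \<partial>lebesgue) = ?I n - ?O n"
    proof -
      have "integrable lebesgue (\<lambda>z. u z * of_real (k * s (k * (cmod (z - centre a n))\<^sup>2)))" if "k > 0" for k
        by (rule integrable_mult_radial_bump[OF loc s that])
      from Bochner_Integration.integral_diff[OF this[of "?N n"] this[of "inverse (?N n)"]] N
      show ?thesis by (simp add: H'_def right_diff_distrib)
    qed
    ultimately show ?thesis by (simp add: H_def)
  qed
  have "?J \<longlonglongrightarrow> - (of_real pi * u a - 0)"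
    unfolding eq by (intro tendsto_intros I O)
  hence "(\<integral>z. v z / (z - a) \<partial>lebesgue) = - (of_real pi * u a)"
    using LIMSEQ_unique[OF J] by simp
  \<comment> \<open>Reversing the kernel from \<open>z - a\<close> to \<open>a - z\<close> cancels
    the sign of the distributional derivative.\<close>
  moreover have "(\<integral>z. v z / (z - a) \<partial>lebesgue) = - (\<integral>z. v z / (a - z) \<partial>lebesgue)"
  proof -
    have "v z / (z - a) = - (v z / (a - z))" for z
      by (metis minus_diff_eq minus_divide_right)
    thus ?thesis by simp
  qed
  ultimately show ?thesis by simp
qed

theorem proposition2p3:
  fixes u v :: "complex \<Rightarrow> complex"
  assumes "v \<in> weighted_L2 (-1)"
    and "u \<in> weighted_L2 1"
    and "distributional_dbar u v"
  shows "AE z in lebesgue.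
           integrable lebesgue (\<lambda>w. 1 / (z - w) * v w) \<and>
           u z = 1 / complex_of_real pi * (\<integral>w. 1 / (z - w) * v w \<partial>lebesgue)"
proof -
  have loc: "locally_integrable u" "locally_integrable v"
    using assms(3) by (simp_all add: distributional_dbar_def)
  have [measurable]: "japanese_bracket \<in> borel_measurable lebesgue"
    unfolding japanese_bracket_def[abs_def] by (intro measurable_completion) measurable
  have v: "v \<in> borel_measurable lebesgue"
    using assms(1) by (auto simp: weighted_L2_def L2_complex_def)
  \<comment> \<open>Almost every point is both a Lebesgue point of \<open>u\<close> and a point
    where the kernel is integrable against \<open>v\<close>; the formula holds at each of
    these.\<close>
  from lebesgue_points[OF loc(1)] Cauchy_kernel_AE_integrable[OF assms(1) loc(2)]
  show ?thesis
  proof eventually_elim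
    case (elim z)
    have "of_real pi * u z = (\<integral>w. v w / (z - w) \<partial>lebesgue)"
      by (rule dbar_representation_at_point[OF v elim(2) assms(2,3)]) (use elim(1) in blast)
    hence "u z = 1 / complex_of_real pi * (\<integral>w. v w / (z - w) \<partial>lebesgue)"
      by (simp add: field_simps)
    with elim(2) show ?case by simp
  qed
qed

end
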